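(* Let $p$ be an odd prime and let $i\in\{1,2,3\}$. Then $$|\mathrm{Aut}(G_{i,1}(\mathbb{F}_p))| = \gcd\!\left(p-1,\lceil 4/i\rceil\right)\cdot|\mathrm{GL}_2(\mathbb{F}_p)|\cdot p^{18}\cdot |E_1[3](\mathbb{F}_p)|,$$ where $E_1$ is the elliptic curve $y^2=x^3-x$ and $E_1[3](\mathbb{F}_p)$ is the group of its $\mathbb{F}_p$-rational points $P$ with $3P=O$ (including the point at infinity $O$).
   Context: Construction: for a field $K$ and a symmetric $3\times 3$ matrix $B(\mathbf y)=\sum_{\kappa=1}^3 B^{(\kappa)}y_\kappa$ of linear forms in $y_1,y_2,y_3$ (each $B^{(\kappa)}\in \mathrm{Mat}_3(K)$ symmetric), let $\phi:K^3\times K^3\to K^3$ be the bilinear map with $\kappa$-th coordinate $\phi(u,w)_\kappa=uB^{(\kappa)}w^{\mathrm T}$ ($u,w$ row vectors). The group $G_B(K)$ is the set $K^3\times K^3\times K^3$ with multiplication $(u,w,t)\star(u',w',t')=(u+u',w+w',t+t'+\phi(u,w'))$. The groups $G_{i,1}(\mathbb{F}_p)=G_{B_{i,1}}(\mathbb{F}_p)$ are defined by the matrices $B_{1,1}=\begin{pmatrix} y_3&-y_2&y_1\\ -y_2&-y_1&0\\ y_1&0&y_3\end{pmatrix}$, $B_{2,1}=\begin{pmatrix} 3y_1+y_3&-y_2&y_1-y_3\\ -y_2&-y_1-y_3&-y_2\\ y_1-y_3&-y_2&-y_1+y_3\end{pmatrix}$, $B_{3,1}=\begin{pmatrix} -3y_1+y_3&-y_2&y_1+y_3\\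 -y_2&-y_1+y_3&y_2\\ y_1+y_3&y_2&y_1+y_3\end{pmatrix}$. These are groups of order $p^9$, exponent $p$ and nilpotency class 2; $\mathrm{Aut}$ denotes the automorphism group of the abstract group. *)

theory Defs
  imports "HOL-Algebra.Bij" "HOL-Computational_Algebra.Primes" Complex_Main
begin

section \<open>The field F_p, modelled as {0..<p} with arithmetic mod p\<close>

definition fp_inv :: "int \<Rightarrow> int \<Rightarrow> int" where
  "fp_inv p x = (x ^ nat (p - 2)) mod p"   \<comment> \<open>inverse in F_p (Fermat), p prime\<close>

definition vecs :: "int \<Rightarrow> (nat \<Rightarrow> int) set" where
  "vecs p = {v. (\<forall>j<3. 0 \<le> v j \<and> v j < p) \<and> (\<forall>j\<ge>3. v j = 0)}"

definition vadd :: "int \<Rightarrow> (nat \<Rightarrow> int) \<Rightarrow> (nat \<Rightarrow> int) \<Rightarrow> (nat \<Rightarrow> int)" where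
  "vadd p u v = (\<lambda>j. if j < 3 then (u j + v j) mod p else 0)"

text \<open>A symmetric matrix of linear forms B(y) is given as a function of y = (y_1,y_2,y_3)
  (indexed 0,1,2) returning the 3x3 matrix as a list of rows.  Its coefficient matrices are
  B^(k) = B(e_k), since B(y) = sum_k B^(k) y_k.\<close>

definition Bcoef :: "((nat \<Rightarrow> int) \<Rightarrow> int list list) \<Rightarrow> nat \<Rightarrow> nat \<Rightarrow> nat \<Rightarrow> int" where
  "Bcoef B k j l = B (\<lambda>i. if i = k then 1 else 0) ! j ! l"

definition phi :: "((nat \<Rightarrow> int) \<Rightarrow> int list list) \<Rightarrow> int \<Rightarrow> (nat \<Rightarrow> int) \<Rightarrow> (nat \<Rightarrow> int) \<Rightarrow> (nat \<Rightarrow> int)" where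
  "phi B p u w = (\<lambda>k. if k < 3 then (\<Sum>j<3. \<Sum>l<3. u j * Bcoef B k j l * w l) mod p else 0)"

definition G_B :: "((nat \<Rightarrow> int) \<Rightarrow> int list list) \<Rightarrow> int
    \<Rightarrow> ((nat \<Rightarrow> int) \<times> (nat \<Rightarrow> int) \<times> (nat \<Rightarrow> int)) monoid" where
  "G_B B p = \<lparr> carrier = vecs p \<times> vecs p \<times> vecs p,
      monoid.mult = (\<lambda>(u, w, t) (u', w', t'). (vadd p u u', vadd p w w', vadd p (vadd p t t') (phi B p u w'))),
      one = ((\<lambda>_. 0), (\<lambda>_. 0), (\<lambda>_. 0)) \<rparr>"

definition B11 :: "(nat \<Rightarrow> int) \<Rightarrow> int list list" where
  "B11 y = [[y 2, - y 1, y 0], [- y 1, - y 0, 0], [y 0, 0, y 2]]"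

definition B21 :: "(nat \<Rightarrow> int) \<Rightarrow> int list list" where
  "B21 y = [[3 * y 0 + y 2, - y 1, y 0 - y 2], [- y 1, - y 0 - y 2, - y 1], [y 0 - y 2, - y 1, - y 0 + y 2]]"

definition B31 :: "(nat \<Rightarrow> int) \<Rightarrow> int list list" where
  "B31 y = [[-3 * y 0 + y 2, - y 1, y 0 + y 2], [- y 1, - y 0 + y 2, y 1], [y 0 + y 2, y 1, y 0 + y 2]]"

definition G_i1 :: "nat \<Rightarrow> int \<Rightarrow> ((nat \<Rightarrow> int) \<times> (nat \<Rightarrow> int) \<times> (nat \<Rightarrow> int)) monoid" where
  "G_i1 i p = G_B (if i = 1 then B11 else if i = 2 then B21 else B31) p"

definition GL2 :: "int \<Rightarrow> (int \<times> int \<times> int \<times> int) set" where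
  "GL2 p = {(a, b, c, d). a \<in> {0..<p} \<and> b \<in> {0..<p} \<and> c \<in> {0..<p} \<and> d \<in> {0..<p}
                         \<and> (a * d - b * c) mod p \<noteq> 0}"

section \<open>Elliptic curve y^2 = x^3 + a x + b over F_p; None is the point at infinity O\<close>

definition on_curve :: "int \<Rightarrow> int \<Rightarrow> int \<Rightarrow> (int \<times> int) option \<Rightarrow> bool" where
  "on_curve p a b P = (case P of None \<Rightarrow> True
     | Some (x, y) \<Rightarrow> x \<in> {0..<p} \<and> y \<in> {0..<p} \<and> (y^2 - (x^3 + a * x + b)) mod p = 0)"

definition ec_add :: "int \<Rightarrow> int \<Rightarrow> (int \<times> int) option \<Rightarrow> (int \<times> int) option \<Rightarrow> (int \<times> int) option" where
  "ec_add p a P Q = (case P of None \<Rightarrow> Q | Some (x1, y1) \<Rightarrow>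
     (case Q of None \<Rightarrow> P | Some (x2, y2) \<Rightarrow>
       (if x1 = x2 \<and> (y1 + y2) mod p = 0 then None
        else let l = (if x1 = x2 then ((3 * x1^2 + a) * fp_inv p (2 * y1)) mod p
                      else ((y2 - y1) * fp_inv p (x2 - x1)) mod p);
                 x3 = (l^2 - x1 - x2) mod p;
                 y3 = (l * (x1 - x3) - y1) mod p
             in Some (x3, y3))))"

definition E1_3tors :: "int \<Rightarrow> (int \<times> int) option set" where
  "E1_3tors p = {P. on_curve p (-1) 0 P \<and> ec_add p (-1) P (ec_add p (-1) P P) = None}"

end

theory Submission
  imports Defs "HOL-Library.Product_Plus" "HOL-Computational_Algebra.Polynomial" "HOL-Number_Theory.Cong"
begin

text \<open>After a change of coordinates the bilinear map \<open>\<phi>\<close> has the normal form \<open>frm r s\<close>.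
  Modulo the center, an automorphism is a linear map of \<open>F\<^sub>p\<^sup>6 = F\<^sub>p\<^sup>2 \<otimes> F\<^sub>p\<^sup>3\<close> preserving the
  commutator form \<open>\<phi>(u, w') - \<phi>(u', w)\<close> up to a linear map of the center. It carries the
  skew-adjoint maps \<open>(u, w) \<mapsto> (w, 0)\<close> and \<open>(u, w) \<mapsto> (0, u)\<close> to skew-adjoint maps; since the
  self-adjoint operators of \<open>\<phi>\<close> are scalars, this forces it to be a tensor \<open>g \<otimes> h\<close> with \<open>g\<close> in
  \<open>GL\<^sub>2\<close> and \<open>h\<close> a similitude of \<open>\<phi>\<close>. Modulo scalars, a similitude is \<open>diag(1, u, u\<^sup>2)\<close>, with
  \<open>u\<^sup>4 = 1\<close> and \<open>ru\<^sup>2 = r\<close>, times either the identity or a matrix attached to one of the affine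
  points of order 3 on \<open>E\<^sub>1\<close>. What is left of an automorphism is a homomorphism from
  \<open>F\<^sub>p\<^sup>6\<close> to the center \<open>F\<^sub>p\<^sup>3\<close>, whence the factor \<open>p\<^sup>1\<^sup>8\<close>.\<close>

section \<open>Vectors and the symmetric bilinear map\<close>

text \<open>One computation serves all three matrices: the normal form has
  \<open>r = - 6 * e\<close> and \<open>s = 4 - 3 * e^2\<close> with \<open>e = 0, 1, -1\<close>.
  Every constant that must not vanish is then a power of 2 up to sign, so \<open>p = 3\<close> is
  special only in the count of the twists. An automorphism need not respect the splitting into
  \<open>u\<close> and \<open>w\<close>. What it must normalise, modulo the center, is the Lie
  algebra of skew-adjoint maps of the commutator form. These are the 2 x 2 block matrices with
  scalar blocks and trace 0, a copy of sl_2, and this is what recovers the tensor structure. The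
  curve enters through the similitudes. Seen as a linear map, \<phi> sends the symmetric square, of
  dimension 6, onto the center, and a similitude must preserve its kernel, which is spanned by three
  quadratic relations. Solving for this gives pairs \<open>(k, m)\<close>, which are disguised
  coordinates of a point together with the slope of its tangent. A factorisation into
  \<open>g\<close> and \<open>h\<close> is unique only up to a scalar; hence the similitudes are
  brought into a normal form before anything is counted.\<close>

type_synonym 'a vec3 = "'a \<times> 'a \<times> 'a"

definition scal :: "'a::times \<Rightarrow> 'a vec3 \<Rightarrow> 'a vec3" where
  "scal k x = (k * fst x, k * fst (snd x), k * snd (snd x))"

lemma scal_simps [simp]: "scal k (a, b, c) = (k * a, k * b, k * c)"
  by (simp add: scal_def)

lemma zero_vec3: "(0 :: 'a::zero vec3) = (0, 0, 0)"
  by (simp add: zero_prod_def)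

lemma four_nonzero:
  assumes "(2::'a::idom) \<noteq> 0"
  shows "(4::'a) \<noteq> 0"
proof -
  have "(4::'a) = 2 * 2"
    by simp
  then show ?thesis
    using assms by (metis mult_eq_0_iff)
qed

lemma scal_add: "scal k (x + y) = scal k x + scal k (y :: 'a::ring vec3)"
  by (simp add: scal_def algebra_simps)

lemma scal_add_left: "scal (j + k) x = scal j x + scal k (x :: 'a::ring vec3)"
  by (simp add: scal_def algebra_simps)

lemma scal_diff_left: "scal (j - k) x = scal j x - scal k (x :: 'a::ring vec3)"
  by (simp add: scal_def algebra_simps)

lemma scal_scal: "scal j (scal k x) = scal (j * k) (x :: 'a::semigroup_mult vec3)"
  by (simp add: scal_def mult.assoc)

lemma scal_0 [simp]: "scal 0 x = (0 :: 'a::ring vec3)" "scal k (0 :: 'a::ring vec3) = 0"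
  by (simp_all add: scal_def zero_prod_def)

lemma scal_1 [simp]: "scal 1 x = (x :: 'a::monoid_mult vec3)"
  by (simp add: scal_def)

lemma scal_eq_0_iff: "scal k x = 0 \<longleftrightarrow> k = 0 \<or> x = (0 :: 'a::field vec3)"
  by (cases x) (auto simp: zero_prod_def)

text \<open>A matrix is the triple of its columns.\<close>

type_synonym 'a mat3 = "'a vec3 \<times> 'a vec3 \<times> 'a vec3"

definition lin :: "'a::ring mat3 \<Rightarrow> 'a vec3 \<Rightarrow> 'a vec3" where
  "lin M x = scal (fst x) (fst M) + scal (fst (snd x)) (fst (snd M)) + scal (snd (snd x)) (snd (snd M))"

lemma lin_simps [simp]: "lin (c1, c2, c3) (x1, x2, x3) = scal x1 c1 + scal x2 c2 + scal x3 c3"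
  by (simp add: lin_def)

lemma lin_basis [simp]:
  fixes c1 :: "'a::ring_1 vec3"
  shows "lin (c1, c2, c3) (1, 0, 0) = c1" "lin (c1, c2, c3) (0, 1, 0) = c2" "lin (c1, c2, c3) (0, 0, 1) = c3"
  by simp_all

lemma lin_add: "lin M (x + y) = lin M x + lin M y"
  by (simp add: lin_def scal_add_left)

lemma lin_scal: "lin M (scal k x) = scal k (lin M (x :: 'a::comm_ring vec3))"
  by (simp add: lin_def scal_def algebra_simps)

lemma lin_0 [simp]: "lin M 0 = 0"
  by (simp add: lin_def)

lemma lin_minus: "lin M (- x) = - lin M x"
  by (metis lin_add lin_0 add_eq_0_iff)

lemma lin_diff: "lin M (x - y) = lin M x - lin M y"
  by (metis lin_add lin_minus diff_conv_add_uminus)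

lemma lin_eqD:
  fixes M N :: "'a::ring_1 mat3"
  assumes "\<And>x. lin M x = lin N x"
  shows "M = N"
  using assms[of "(1,0,0)"] assms[of "(0,1,0)"] assms[of "(0,0,1)"]
  by (cases M; cases N) (simp del: lin_simps)

text \<open>Every scalar of a prime field is a repeated sum of 1, so additivity already gives
  homogeneity. This is why automorphisms of the abstract group are linear modulo the center, with no
  field automorphisms to account for.\<close>

lemma additive_eq_lin:
  fixes f :: "'a::comm_ring_1 vec3 \<Rightarrow> 'a vec3"
  assumes prime_field: "\<And>x::'a. \<exists>n. x = of_nat n"
    and add: "\<And>x y. f (x + y) = f x + f y"
  shows "f = lin (f (1,0,0), f (0,1,0), f (0,0,1))"
proof
  have f0: "f 0 = 0"
    using add[of 0 0] by simp
  have f_of_nat: "f (scal (of_nat n) x) = scal (of_nat n) (f x)" for n x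
    by (induction n) (simp_all add: f0 scal_add_left add)
  have f_scal: "f (scal k x) = scal k (f x)" for k x
    by (metis prime_field f_of_nat)
  fix x :: "'a vec3"
  obtain a b c where x: "x = (a, b, c)"
    by (cases x)
  have "x = scal a (1,0,0) + scal b (0,1,0) + scal c (0,0,1)"
    by (simp add: x)
  then have "f x = scal a (f (1,0,0)) + scal b (f (0,1,0)) + scal c (f (0,0,1))"
    by (metis add f_scal)
  then show "f x = lin (f (1,0,0), f (0,1,0), f (0,0,1)) x"
    by (simp add: x)
qed

definition frm :: "'a::comm_ring_1 \<Rightarrow> 'a \<Rightarrow> 'a vec3 \<Rightarrow> 'a vec3 \<Rightarrow> 'a vec3" where
  "frm r s = (\<lambda>(x1, x2, x3) (y1, y2, y3).
     (x1 * y3 + x3 * y1 - 2 * x2 * y2, x1 * y2 + x2 * y1, x3 * y3 + r * x2 * y2 + s * x1 * y1))"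

lemma frm_simps [simp]:
  "frm r s (x1, x2, x3) (y1, y2, y3) =
     (x1 * y3 + x3 * y1 - 2 * x2 * y2, x1 * y2 + x2 * y1, x3 * y3 + r * x2 * y2 + s * x1 * y1)"
  by (simp add: frm_def)

lemma frm_commute: "frm r s x y = frm r s y x"
  by (cases x; cases y) (simp add: algebra_simps)

lemma frm_add_left: "frm r s (x + x') y = frm r s x y + frm r s x' y"
  by (cases x; cases x'; cases y) (simp add: algebra_simps)

lemma frm_add_right: "frm r s y (x + x') = frm r s y x + frm r s y x'"
  by (metis frm_commute frm_add_left)

lemma frm_scal_left: "frm r s (scal k x) y = scal k (frm r s x y)"
  by (cases x; cases y) (simp add: algebra_simps)

lemma frm_scal_right: "frm r s y (scal k x) = scal k (frm r s y x)"
  by (metis frm_commute frm_scal_left)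

lemma frm_0 [simp]: "frm r s 0 y = 0" "frm r s y 0 = 0"
  by (cases y; simp add: zero_prod_def)+

lemma frm_minus_left: "frm r s (- x) y = - frm r s x y"
  by (cases x; cases y) (simp add: algebra_simps)

lemma frm_minus_right: "frm r s x (- y) = - frm r s x y"
  by (cases x; cases y) (simp add: algebra_simps)

lemmas frm_bilinear = frm_add_left frm_add_right frm_scal_left frm_scal_right
  frm_minus_left frm_minus_right

lemma frm_nondegenerate:
  assumes "\<And>y. frm r s x y = 0"
  shows "x = 0"
  using assms[of "(1,0,0)"] assms[of "(0,0,1)"] by (cases x) (auto simp: zero_prod_def)

text \<open>Testing on pairs of basis vectors gives sparse linear equations for the 18 entries: the
  off-diagonal ones vanish, then the diagonal ones agree. Two maps \<open>M\<close> and
  \<open>N\<close> are allowed because the diagonal blocks of a skew-adjoint map are adjoint to each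
  other only up to sign.\<close>

lemma frm_adjoint_imp_scalar:
  fixes r s :: "'a::field"
  assumes two: "(2::'a) \<noteq> 0" and s: "s \<noteq> 0"
    and adj: "\<And>x y. frm r s (lin M x) y = frm r s x (lin N y)"
  shows "\<exists>k. (\<forall>x. lin M x = scal k x) \<and> (\<forall>x. lin N x = scal k x)"
proof -
  obtain x11 x12 x13 x21 x22 x23 x31 x32 x33
    where M: "M = ((x11, x12, x13), (x21, x22, x23), (x31, x32, x33))"
    by (metis prod_cases3)
  obtain y11 y12 y13 y21 y22 y23 y31 y32 y33
    where N: "N = ((y11, y12, y13), (y21, y22, y23), (y31, y32, y33))"
    by (metis prod_cases3)
  note eqs = adj[of "(1,0,0)" "(1,0,0)"] adj[of "(1,0,0)" "(0,1,0)"] adj[of "(1,0,0)" "(0,0,1)"]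
    adj[of "(0,1,0)" "(1,0,0)"] adj[of "(0,1,0)" "(0,1,0)"] adj[of "(0,1,0)" "(0,0,1)"]
    adj[of "(0,0,1)" "(1,0,0)"] adj[of "(0,0,1)" "(0,1,0)"] adj[of "(0,0,1)" "(0,0,1)"]
  have off: "y32 = 0" "x32 = 0" "x31 = 0" "x21 = 0" "x23 = 0" "y21 = 0" "y23 = 0" "x12 = 0"
    "y12 = 0" "y31 = 0" "x13 = 0" "y13 = 0"
    using eqs two s by (simp_all add: M N zero_prod_def)
  have diag: "y22 = x11" "y33 = x11" "y11 = x11" "x22 = x11" "x33 = x11"
    using eqs two s by (simp_all add: M N off)
  show ?thesis
    by (rule exI[of _ x11]) (auto simp: M N off diag zero_prod_def mult.commute)
qed

section \<open>The similitudes of the bilinear map\<close>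

text \<open>The products of basis vectors satisfy \<open>e2 e3 = 0\<close>,
  \<open>e1 e1 = s e3 e3\<close> and \<open>e2 e2 = - 2 e1 e3 + r e3 e3\<close>. The columns of
  \<open>h\<close> have to satisfy the same three relations, so no multiplier need be named.\<close>

definition similitude :: "'a::comm_ring_1 \<Rightarrow> 'a \<Rightarrow> 'a mat3 \<Rightarrow> bool" where
  "similitude r s = (\<lambda>(h1, h2, h3). frm r s h2 h3 = 0 \<and>
     frm r s h1 h1 = scal s (frm r s h3 h3) \<and>
     frm r s h2 h2 = scal (- 2) (frm r s h1 h3) + scal r (frm r s h3 h3))"

text \<open>The standard basis vectors are the products \<open>e1 e3\<close>, \<open>e1 e2\<close>
  and \<open>e3 e3\<close>, which forces these columns.\<close>

definition multiplier :: "'a::comm_ring_1 \<Rightarrow> 'a \<Rightarrow> 'a mat3 \<Rightarrow> 'a mat3" where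
  "multiplier r s = (\<lambda>(h1, h2, h3). (frm r s h1 h3, frm r s h1 h2, frm r s h3 h3))"

lemma similitude_frm:
  assumes "similitude r s h"
  shows "frm r s (lin h x) (lin h y) = lin (multiplier r s h) (frm r s x y)"
proof -
  obtain h1 h2 h3 where h: "h = (h1, h2, h3)"
    by (cases h)
  obtain x1 x2 x3 y1 y2 y3 where xy: "x = (x1, x2, x3)" "y = (y1, y2, y3)"
    by (metis prod_cases3)
  have eqs: "frm r s h2 h3 = 0" "frm r s h1 h1 = scal s (frm r s h3 h3)"
    "frm r s h2 h2 = scal (- 2) (frm r s h1 h3) + scal r (frm r s h3 h3)"
    using assms by (simp_all add: similitude_def h)
  have "frm r s (lin h x) (lin h y) =
      scal (x1 * y1) (frm r s h1 h1) + scal (x1 * y2 + x2 * y1) (frm r s h1 h2)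
      + scal (x1 * y3 + x3 * y1) (frm r s h1 h3) + scal (x2 * y2) (frm r s h2 h2)
      + scal (x2 * y3 + x3 * y2) (frm r s h2 h3) + scal (x3 * y3) (frm r s h3 h3)"
    by (simp add: h xy frm_bilinear scal_add scal_scal scal_add_left
        frm_commute[of r s h2 h1] frm_commute[of r s h3 h1] frm_commute[of r s h3 h2] mult.commute)
  then show ?thesis
    unfolding eqs
    by (cases "frm r s h1 h2"; cases "frm r s h1 h3"; cases "frm r s h3 h3")
      (simp add: h xy multiplier_def algebra_simps)
qed

lemma similitudeI:
  assumes "\<And>x y. frm r s (lin h x) (lin h y) = lin N (frm r s x y)"
  shows "similitude r s h"
proof -
  obtain h1 h2 h3 n1 n2 n3 where hN: "h = (h1, h2, h3)" "N = (n1, n2, n3)"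
    by (metis prod_cases3)
  note eqs = assms[of "(0,1,0)" "(0,0,1)"] assms[of "(1,0,0)" "(1,0,0)"] assms[of "(0,0,1)" "(0,0,1)"]
    assms[of "(0,1,0)" "(0,1,0)"] assms[of "(1,0,0)" "(0,0,1)"]
  have "frm r s h2 h3 = 0" "frm r s h1 h1 = scal s n3" "frm r s h3 h3 = n3"
    "frm r s h2 h2 = scal (- 2) n1 + scal r n3" "frm r s h1 h3 = n1"
    using eqs unfolding hN lin_basis frm_simps by simp_all
  then show ?thesis
    by (simp add: similitude_def hN)
qed

text \<open>In a similitude with first row \<open>(a, m, 1)\<close>, the numbers
  \<open>a = k^2\<close> and \<open>b = k (k + 2 m)\<close> have product \<open>s\<close> and sum
  \<open>m^2 + r\<close>; these are the two equations.\<close>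

definition tpairs :: "'a::comm_ring_1 \<Rightarrow> 'a \<Rightarrow> ('a \<times> 'a) set" where
  "tpairs r s = {(k, m). k ^ 3 * (k + 2 * m) = s \<and> m\<^sup>2 - 2 * k * m - 2 * k\<^sup>2 + r = 0}"

definition twists :: "'a::comm_ring_1 \<Rightarrow> 'a set" where
  "twists r = {u. u ^ 4 = 1 \<and> r * u\<^sup>2 = r}"

text \<open>Up to scalars, the similitudes are these matrices: first row either \<^term>\<open>(1, 0, 0)\<close>
  or \<^term>\<open>(k\<^sup>2, m, 1)\<close>.\<close>

fun smat :: "'a::comm_ring_1 \<Rightarrow> ('a \<times> 'a) option \<Rightarrow> 'a mat3" where
  "smat u None = ((1, 0, 0), (0, u, 0), (0, 0, u\<^sup>2))"
| "smat u (Some (k, m)) =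
    ((k\<^sup>2, u * k\<^sup>2 * (k + 2 * m), - u\<^sup>2 * k\<^sup>2 * (k - m) * (k + 2 * m)),
     (m, - u * k * m, - u\<^sup>2 * k * m * (k - m)),
     (1, u * k, - u\<^sup>2 * k * (k + m)))"

lemma similitude_smat:
  fixes r s :: "'a::field"
  assumes u: "u \<in> twists r" and tp: "\<And>k m. q = Some (k, m) \<Longrightarrow> (k, m) \<in> tpairs r s"
  shows "similitude r s (smat u q)"
proof (cases q)
  case None
  then show ?thesis
    using u by (simp add: similitude_def twists_def zero_prod_def power2_eq_square power4_eq_xxxx mult.assoc)
next
  case (Some km)
  obtain k m where km: "km = (k, m)"
    by (cases km)
  define X where "X = u\<^sup>2"
  have X: "X * X = 1" "r * X = r" "u * u = X"
    using u by (auto simp: twists_def X_def power2_eq_square power4_eq_xxxx mult.assoc)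
  have "(k, m) \<in> tpairs r s"
    using tp Some km by blast
  then have s: "s = k ^ 3 * (k + 2 * m)" and r: "r = 2 * k * m + 2 * k\<^sup>2 - m\<^sup>2"
    by (auto simp: tpairs_def algebra_simps eq_neg_iff_add_eq_0)
  show ?thesis
    unfolding similitude_def Some km smat.simps X_def[symmetric] case_prod_conv frm_simps scal_simps
      add_Pair zero_vec3 prod.inject
    using X s r by (intro conjI) algebra+
qed

section \<open>Invertibility of the normal forms and classification of the similitudes\<close>

lemma tpairs_nonzero:
  fixes r s :: "'a::field"
  assumes two: "(2::'a) \<noteq> 0" and s: "s \<noteq> 0" and disc: "r\<^sup>2 \<noteq> 4 * s" and km: "(k, m) \<in> tpairs r s"
  shows "k \<noteq> 0" "m \<noteq> 0" "k + 2 * m \<noteq> 0"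
proof -
  have eqs: "k ^ 3 * (k + 2 * m) = s" "m\<^sup>2 - 2 * k * m - 2 * k\<^sup>2 + r = 0"
    using km by (auto simp: tpairs_def)
  show "k \<noteq> 0" "k + 2 * m \<noteq> 0"
    using s eqs by auto
  show "m \<noteq> 0"
  proof
    \<comment> \<open>For \<open>m = 0\<close> the two equations read \<open>s = k^4\<close> and
      \<open>r = 2 k^2\<close>, the degenerate case that \<open>disc\<close> excludes.\<close>
    assume "m = 0"
    then have "k ^ 4 = s" "r = 2 * k\<^sup>2"
      using eqs by (auto simp: eval_nat_numeral)
    then have "r\<^sup>2 = 4 * s"
      by (auto simp: eval_nat_numeral)
    then show False
      using disc by simp
  qed
qed

lemma twists_nonzero: "u \<in> twists r \<Longrightarrow> u \<noteq> (0::'a::field)"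
  by (auto simp: twists_def)

text \<open>After nonzero factors of the rows are removed, the first two rows force
  \<open>x2 = k x1\<close> and \<open>x3 = - (k^2 + m k) x1\<close> for a vector of the kernel; the
  third row then reads \<open>- 4 k m^2 x1 = 0\<close>.\<close>

lemma inj_smat:
  fixes r s :: "'a::field"
  assumes two: "(2::'a) \<noteq> 0" and s: "s \<noteq> 0" and disc: "r\<^sup>2 \<noteq> 4 * s"
    and u: "u \<in> twists r" and tp: "\<And>k m. q = Some (k, m) \<Longrightarrow> (k, m) \<in> tpairs r s"
  shows "inj (lin (smat u q))"
proof -
  have u0: "u \<noteq> 0"
    using u by (rule twists_nonzero)
  have zero: "x = 0" if "lin (smat u q) x = 0" for x
  proof (cases q)
    case None
    then show ?thesis
      using that u0 by (cases x) (auto simp: zero_prod_def)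
  next
    case (Some km)
    obtain k m where km: "km = (k, m)"
      by (cases km)
    have nz: "k \<noteq> 0" "m \<noteq> 0" "k + 2 * m \<noteq> 0"
      using tpairs_nonzero[OF two s disc] tp Some km by blast+
    obtain x1 x2 x3 where x: "x = (x1, x2, x3)"
      by (cases x)
    have e1: "k\<^sup>2 * x1 + m * x2 + x3 = 0"
      using that by (simp add: Some km x zero_prod_def algebra_simps)
    have "u * k * (k * (k + 2 * m) * x1 - m * x2 + x3) = 0"
      using that by (simp add: Some km x zero_prod_def algebra_simps power2_eq_square)
    then have e2: "k * (k + 2 * m) * x1 - m * x2 + x3 = 0"
      using u0 nz by simp
    have "u * u * k * (k * (k - m) * (k + 2 * m) * x1 + m * (k - m) * x2 + (k + m) * x3) = 0"
      using that unfolding Some km x by (simp add: zero_prod_def algebra_simps power2_eq_square)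
    then have e3: "k * (k - m) * (k + 2 * m) * x1 + m * (k - m) * x2 + (k + m) * x3 = 0"
      using u0 nz by simp
    have "2 * m * (x2 - k * x1) = 0"
      using e1 e2 by algebra
    then have x2: "x2 = k * x1"
      using two nz by simp
    have x3: "x3 = - (k\<^sup>2 + m * k) * x1"
      using e1 x2 by algebra
    have four: "(4::'a) \<noteq> 0"
      using two by (rule four_nonzero)
    have "4 * k * m * m * x1 = 0"
      using e3 unfolding x2 x3 by algebra
    then have "x1 = 0"
      using four nz by simp
    then show ?thesis
      by (simp add: x x2 x3 zero_prod_def)
  qed
  show ?thesis
  proof (rule injI)
    fix x y
    assume "lin (smat u q) x = lin (smat u q) y"
    then have "lin (smat u q) (x - y) = 0"
      by (simp add: lin_diff)
    then have "x - y = 0"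
      by (rule zero)
    then show "x = y"
      by simp
  qed
qed

text \<open>With \<open>b = b1 / v\<close>, the numbers \<open>a\<close> and \<open>b\<close> have
  product \<open>s\<close> and sum \<open>m^2 + r\<close>, and the relation
  \<open>(b - a)^2 = 4 a m^2\<close> exhibits \<open>a\<close> as a square \<open>k^2\<close>. The
  other equations then determine the third row and make \<open>u = v / k\<close> a twist.\<close>

lemma similitude_normalised:
  fixes r s :: "'a::field"
  assumes two: "(2::'a) \<noteq> 0" and s: "s \<noteq> 0"
    and sim: "similitude r s ((a, b1, c1), (m, b2, c2), (1, v, y))" and v: "v \<noteq> 0"
    and not_prop: "b1 \<noteq> v * a \<or> b2 \<noteq> v * m"
  shows "\<exists>u k. u \<in> twists r \<and> (k, m) \<in> tpairs r s \<and>
    ((a, b1, c1), (m, b2, c2), (1, v, y)) = smat u (Some (k, m))"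
proof -
  have F1: "m * y + c2 = 2 * b2 * v" and F2: "b2 = - m * v" and F3: "c2 * y + r * b2 * v + s * m = 0"
    and F4: "2 * a * c1 - 2 * b1\<^sup>2 = s * (2 * y - 2 * v\<^sup>2)" and F5: "2 * a * b1 = s * (2 * v)"
    and F6: "c1\<^sup>2 + r * b1\<^sup>2 + s * a\<^sup>2 = s * (y\<^sup>2 + r * v\<^sup>2 + s)"
    and F7: "2 * m * c2 - 2 * b2\<^sup>2 = - 2 * (a * y + c1 - 2 * b1 * v) + r * (2 * y - 2 * v\<^sup>2)"
    and F8: "2 * m * b2 = - 2 * (a * v + b1) + r * (2 * v)"
    and F9: "c2\<^sup>2 + r * b2\<^sup>2 + s * m\<^sup>2 = - 2 * (c1 * y + r * b1 * v + s * a) + r * (y\<^sup>2 + r * v\<^sup>2 + s)"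
    using sim unfolding similitude_def case_prod_conv frm_simps scal_simps add_Pair zero_vec3 prod.inject
    by algebra+
  define b where "b = b1 / v"
  have b1: "b1 = b * v"
    using v by (simp add: b_def)
  have "2 * v * (a * b - s) = 0"
    using F5 b1 by algebra
  then have ab: "a * b = s"
    using two v by simp
  have "2 * v * (a + b - (m\<^sup>2 + r)) = 0"
    using F8 F2 b1 by algebra
  then have a_plus_b: "a + b = m\<^sup>2 + r"
    using two v by simp
  have a0: "a \<noteq> 0" and b0: "b \<noteq> 0"
    using ab s by auto
  have "2 * v\<^sup>2 * ((b - a)\<^sup>2 - 4 * a * m\<^sup>2) = 0"
    using F1 F2 F4 F7 b1 ab a_plus_b by algebra
  then have square: "(b - a)\<^sup>2 = 4 * a * m\<^sup>2"
    using two v by simp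
  \<comment> \<open>For \<open>m = 0\<close> the first two rows would be proportional, against
    \<open>not_prop\<close>.\<close>
  have m0: "m \<noteq> 0"
  proof
    assume "m = 0"
    then have "b = a"
      using square by simp
    then show False
      using not_prop F2 b1 \<open>m = 0\<close> by simp
  qed
  \<comment> \<open>Dividing \<open>(b - a)^2 = 4 a m^2\<close> by \<open>4 m^2\<close> shows that
    this is a square root of \<open>a\<close>; its sign is chosen so that
    \<open>b = k (k + 2 m)\<close>.\<close>
  define k where "k = (b - a) / (2 * m)"
  have ba: "b - a = 2 * k * m"
    using two m0 by (simp add: k_def)
  have four: "(4::'a) \<noteq> 0"
    using two by (rule four_nonzero)
  have "4 * m\<^sup>2 * (a - k\<^sup>2) = 0"
    using square ba by algebra
  then have a: "a = k\<^sup>2"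
    using four m0 by simp
  have b: "b = k * (k + 2 * m)"
    using ba a by algebra
  have k0: "k \<noteq> 0" and k2m: "k + 2 * m \<noteq> 0"
    using a a0 b b0 by auto
  have s_eq: "s = k ^ 3 * (k + 2 * m)"
    unfolding ab[symmetric] a b by (simp add: eval_nat_numeral)
  have r_eq: "r = 2 * k * m + 2 * k\<^sup>2 - m\<^sup>2"
    using a_plus_b a b by algebra
  define u where "u = v / k"
  define X where "X = u\<^sup>2"
  have v_eq: "v = u * k"
    using k0 by (simp add: u_def)
  have vv: "v\<^sup>2 = X * k\<^sup>2"
    by (simp add: v_eq X_def power_mult_distrib)
  have X0: "X \<noteq> 0"
    using v v_eq by (auto simp: X_def)
  have c2: "c2 = - 2 * m * X * k\<^sup>2 - m * y"
    using F1 F2 vv by algebra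
  have "2 * k\<^sup>2 * (c1 - (k + 2 * m) * (k * y + 2 * m * X * k\<^sup>2)) = 0"
    using F4 a b b1 s_eq vv by algebra
  then have c1: "c1 = (k + 2 * m) * (k * y + 2 * m * X * k\<^sup>2)"
    using two k0 by simp
  have "m * (y\<^sup>2 + 2 * X * k\<^sup>2 * y + r * X * k\<^sup>2 - s) = 0"
    using F3 F2 c2 vv by algebra
  then have Q: "y\<^sup>2 + 2 * X * k\<^sup>2 * y + r * X * k\<^sup>2 - s = 0"
    using m0 by simp
  have "4 * m\<^sup>2 * k ^ 3 * (k + 2 * m) * (2 * X * y + (k + 2 * m) * k * X\<^sup>2 + k\<^sup>2) = 0"
    using F6 Q a b b1 c1 s_eq vv by algebra
  then have R1: "2 * X * y + (k + 2 * m) * k * X\<^sup>2 + k\<^sup>2 = 0"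
    using four m0 k0 k2m by simp
  have "4 * m\<^sup>2 * k\<^sup>2 * (k\<^sup>2 * X\<^sup>2 + k * (k + 2 * m) + 2 * X * y) = 0"
    using F9 F2 Q a b b1 c1 c2 s_eq r_eq vv by algebra
  then have R2: "k\<^sup>2 * X\<^sup>2 + k * (k + 2 * m) + 2 * X * y = 0"
    using four m0 k0 by simp
  \<comment> \<open>\<open>R1\<close> and \<open>R2\<close> differ only in that the coefficient of
    \<open>X^2\<close> and the constant term are exchanged, so their difference is a multiple of
    \<open>X^2 - 1\<close>.\<close>
  have "2 * m * k * (X\<^sup>2 - 1) = 0"
    using R1 R2 by algebra
  then have XX: "X\<^sup>2 = 1"
    using two m0 k0 by simp
  have "2 * y = 2 * (- X * k * (k + m))"
    using R2 XX by algebra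
  then have y: "y = - X * k * (k + m)"
    using two mult_left_cancel by blast
  have "k\<^sup>2 * (r * X - r) = 0"
    using Q y XX s_eq r_eq by algebra
  then have rX: "r * X = r"
    using k0 by simp
  have "u \<in> twists r"
    using XX rX by (simp add: twists_def X_def flip: power_mult)
  moreover have "(k, m) \<in> tpairs r s"
    using s_eq r_eq by (simp add: tpairs_def)
  moreover have "((a, b1, c1), (m, b2, c2), (1, v, y)) = smat u (Some (k, m))"
  proof -
    have "b1 = u * k\<^sup>2 * (k + 2 * m)"
      by (simp add: b1 b v_eq power2_eq_square mult_ac)
    moreover have "c1 = - X * k\<^sup>2 * (k - m) * (k + 2 * m)"
      using c1 y by algebra
    moreover have "b2 = - u * k * m"
      using F2 by (simp add: v_eq mult_ac)
    moreover have "c2 = - X * k * m * (k - m)"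
      using c2 y by algebra
    ultimately show ?thesis
      using a v_eq y by (simp add: X_def)
  qed
  ultimately show ?thesis
    by blast
qed

definition smat_params :: "'a::comm_ring_1 \<Rightarrow> 'a \<Rightarrow> ('a \<times> ('a \<times> 'a) option) set" where
  "smat_params r s = twists r \<times> insert None (Some ` tpairs r s)"

lemma similitude_scal:
  assumes "similitude r s (h1, h2, h3)"
  shows "similitude r s (scal k h1, scal k h2, scal k h3)"
proof -
  have "scal c (scal (k * k) x) = scal (k * k) (scal c x)" for c and x :: "'a vec3"
    by (simp add: scal_scal mult.commute)
  then show ?thesis
    using assms by (simp add: similitude_def frm_bilinear scal_scal scal_add mult.commute mult.left_commute)
qed

text \<open>If \<open>a3\<close> and \<open>b3\<close> are both nonzero, division by
  \<open>a3\<close> leads to the normalised case. If one of them vanishes, the equations make one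
  entry after another vanish until \<open>M\<close> is diagonal, and what is left of them says that
  it is a multiple of a twist.\<close>

lemma similitude_classification:
  fixes r s :: "'a::field"
  assumes two: "(2::'a) \<noteq> 0" and s: "s \<noteq> 0"
    and sim: "similitude r s M" and bij: "bij (lin M)"
  shows "\<exists>l u q. l \<noteq> 0 \<and> (u, q) \<in> smat_params r s \<and> (\<forall>x. lin M x = scal l (lin (smat u q) x))"
proof -
  obtain a1 b1 c1 a2 b2 c2 a3 b3 c3 where M: "M = ((a1, b1, c1), (a2, b2, c2), (a3, b3, c3))"
    by (metis prod_cases3)
  \<comment> \<open>The first two rows of a surjective matrix are independent: a relation between
    them would hold between the first two coordinates of every vector.\<close>
  have rows: "x = 0 \<and> y = 0" if "x * a1 + y * b1 = 0" "x * a2 + y * b2 = 0" "x * a3 + y * b3 = 0" for x y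
  proof -
    have *: "x * fst (lin M v) + y * fst (snd (lin M v)) = 0" for v
    proof -
      obtain v1 v2 v3 where v: "v = (v1, v2, v3)"
        by (cases v)
      have "x * fst (lin M v) + y * fst (snd (lin M v)) =
          v1 * (x * a1 + y * b1) + v2 * (x * a2 + y * b2) + v3 * (x * a3 + y * b3)"
        by (simp add: M v algebra_simps)
      then show ?thesis
        by (simp add: that)
    qed
    obtain v w where "lin M v = (1, 0, 0)" "lin M w = (0, 1, 0)"
      using bij by (metis bij_pointE)
    with *[of v] *[of w] show ?thesis
      by simp
  qed
  have cols: "x = 0" if "lin M x = 0" for x
    using bij that by (metis bij_is_inj injD lin_0)
  have col3: "\<not> (a3 = 0 \<and> b3 = 0 \<and> c3 = 0)"
    using cols[of "(0,0,1)"] by (auto simp: M zero_prod_def)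
  have G1: "a2 * c3 + c2 * a3 = 2 * b2 * b3" and G2: "a2 * b3 + b2 * a3 = 0"
    and G3: "c2 * c3 + r * b2 * b3 + s * a2 * a3 = 0"
    and G4: "2 * a1 * c1 - 2 * b1 * b1 = s * (2 * a3 * c3 - 2 * b3 * b3)"
    and G5: "2 * a1 * b1 = 2 * s * a3 * b3"
    and G6: "c1 * c1 + r * b1 * b1 + s * a1 * a1 = s * (c3 * c3 + r * b3 * b3 + s * a3 * a3)"
    and G7: "2 * a2 * c2 - 2 * b2 * b2 = - 2 * (a1 * c3 + c1 * a3 - 2 * b1 * b3) + r * (2 * a3 * c3 - 2 * b3 * b3)"
    and G8: "2 * a2 * b2 = - 2 * (a1 * b3 + b1 * a3) + 2 * r * a3 * b3"
    and G9: "c2 * c2 + r * b2 * b2 + s * a2 * a2 =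
      - 2 * (c1 * c3 + r * b1 * b3 + s * a1 * a3) + r * (c3 * c3 + r * b3 * b3 + s * a3 * a3)"
    using sim unfolding similitude_def M case_prod_conv frm_simps scal_simps add_Pair zero_vec3 prod.inject
    by algebra+
  show ?thesis
  proof (cases "a3 = 0 \<or> b3 = 0")
    case False
    then have a3: "a3 \<noteq> 0" and b3: "b3 \<noteq> 0"
      by auto
    have normalised: "similitude r s ((a1 / a3, b1 / a3, c1 / a3), (a2 / a3, b2 / a3, c2 / a3), (1, b3 / a3, c3 / a3))"
      using similitude_scal[OF sim[unfolded M], of "1 / a3"] a3 by simp
    have "b1 / a3 \<noteq> b3 / a3 * (a1 / a3) \<or> b2 / a3 \<noteq> b3 / a3 * (a2 / a3)"
    proof (rule ccontr)
      assume "\<not> ?thesis"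
      then have "- b3 * a1 + a3 * b1 = 0" "- b3 * a2 + a3 * b2 = 0"
        using a3 by (auto simp: field_simps)
      then show False
        using rows[of "- b3" a3] a3 by simp
    qed
    then obtain u k where uk: "u \<in> twists r" "(k, a2 / a3) \<in> tpairs r s"
      and eq: "((a1 / a3, b1 / a3, c1 / a3), (a2 / a3, b2 / a3, c2 / a3), (1, b3 / a3, c3 / a3)) = smat u (Some (k, a2 / a3))"
      using similitude_normalised[OF two s normalised] a3 b3 by auto
    have "lin M x = scal a3 (lin (smat u (Some (k, a2 / a3))) x)" for x
      unfolding eq[symmetric] using a3 by (cases x) (simp add: M distrib_left mult.left_commute)
    with uk a3 show ?thesis
      unfolding smat_params_def by blast
  next
    case True
    have a3: "a3 = 0"
    proof (rule ccontr)
      assume "a3 \<noteq> 0"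
      with True have "b3 = 0"
        by simp
      then have "b2 = 0"
        using G2 \<open>a3 \<noteq> 0\<close> by simp
      then have "b1 = 0"
        using G8 \<open>b3 = 0\<close> \<open>a3 \<noteq> 0\<close> two by simp
      then show False
        using rows[of 0 1] \<open>b2 = 0\<close> \<open>b3 = 0\<close> by simp
    qed
    have a2: "a2 = 0"
    proof (rule ccontr)
      assume "a2 \<noteq> 0"
      then have b3: "b3 = 0"
        using G2 a3 by simp
      then have "b2 = 0" "c3 = 0"
        using G8 G1 a3 two \<open>a2 \<noteq> 0\<close> by simp_all
      then show False
        using col3 a3 b3 by simp
    qed
    have a1: "a1 \<noteq> 0"
      using rows[of 1 0] a2 a3 by auto
    have b1: "b1 = 0"
      using G5 a1 a3 two by simp
    have b3: "b3 = 0"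
      using G8 a1 a2 a3 two by simp
    have c1: "c1 = 0"
      using G4 a1 a3 b1 b3 two by simp
    have "2 * (a1 * c3) = 2 * (b2 * b2)"
      using G7 a2 a3 b3 c1 by algebra
    then have c3: "a1 * c3 = b2 * b2"
      using two mult_left_cancel by blast
    have c30: "c3 \<noteq> 0"
      using col3 a3 b3 by simp
    have c2: "c2 = 0"
      using G3 a2 b3 c30 by simp
    have sq: "c3 * c3 = a1 * a1"
      using G6 s by (simp add: a3 b1 b3 c1)
    have rb: "r * (b2 * b2) = r * (c3 * c3)"
      using G9 by (simp add: a2 a3 b1 b3 c1 c2 mult.assoc)
    define u where "u = b2 / a1"
    have b2: "b2 = a1 * u"
      using a1 by (simp add: u_def)
    have c3u: "c3 = a1 * u\<^sup>2"
      using c3 a1 unfolding b2 by (simp add: power2_eq_square mult_ac)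
    have "u ^ 4 = 1"
      using sq a1 unfolding c3u by (simp add: mult_ac power2_eq_square power4_eq_xxxx)
    moreover have "r * u\<^sup>2 = r"
    proof -
      have "(a1 * a1) * (r * u\<^sup>2) = (a1 * a1) * r"
        using rb sq unfolding b2 by (simp add: power2_eq_square mult_ac)
      then show ?thesis
        using a1 by simp
    qed
    ultimately have "(u, None) \<in> smat_params r s"
      by (simp add: smat_params_def twists_def)
    moreover have "lin M x = scal a1 (lin (smat u None) x)" for x
      by (cases x) (simp add: M a2 a3 b1 b3 c1 c2 b2 c3u mult_ac)
    ultimately show ?thesis
      using a1 by blast
  qed
qed

text \<open>The first row, \<open>(1, 0, 0)\<close> or \<open>(k^2, m, 1)\<close>, separates the two
  kinds and fixes the scalar. In the second kind \<open>k^2\<close>, \<open>m\<close> and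
  \<open>u * k\<close> still allow \<open>(- u, - k)\<close> in place of \<open>(u, k)\<close>; the
  first entry of the second row tells these apart because \<open>m\<close> is nonzero.\<close>

lemma smat_scal_eqD:
  fixes r s :: "'a::field"
  assumes two: "(2::'a) \<noteq> 0" and s: "s \<noteq> 0" and disc: "r\<^sup>2 \<noteq> 4 * s"
    and p: "(u, q) \<in> smat_params r s" "(u', q') \<in> smat_params r s"
    and l: "l \<noteq> 0" and eq: "\<And>x. lin (smat u q) x = scal l (lin (smat u' q') x)"
  shows "u = u' \<and> q = q'"
proof -
  note eqs = eq[of "(1,0,0)"] eq[of "(0,1,0)"] eq[of "(0,0,1)"]
  consider "q = None" "q' = None" | k m where "q = None" "q' = Some (k, m)"
    | k m where "q = Some (k, m)" "q' = None"
    | k m k' m' where "q = Some (k, m)" "q' = Some (k', m')"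
    by (cases q; cases q') auto
  then show ?thesis
  proof cases
    case 1
    then show ?thesis
      using eqs by (auto simp: zero_prod_def)
  next
    case 2
    then show ?thesis
      using eqs l by (auto simp: zero_prod_def)
  next
    case 3
    then show ?thesis
      using eqs l by (auto simp: zero_prod_def)
  next
    case 4
    have tp: "(k, m) \<in> tpairs r s"
      using p 4 by (auto simp: smat_params_def)
    note nz = tpairs_nonzero[OF two s disc tp]
    have "l = 1"
      using eqs(3) unfolding 4 smat.simps lin_basis by simp
    have m: "m = m'" and uk: "u * k = u' * k'" and kk: "k\<^sup>2 = k'\<^sup>2"
      and cubic: "u * k\<^sup>2 * (k + 2 * m) = u' * k'\<^sup>2 * (k' + 2 * m')"
      using eqs unfolding 4 smat.simps lin_basis \<open>l = 1\<close> scal_1 prod.inject by blast+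
    have "(u * k) * (k * (k + 2 * m)) = (u' * k') * (k' * (k' + 2 * m'))"
      using cubic by (simp only: power2_eq_square mult_ac)
    then have "(u * k) * (k * (k + 2 * m)) = (u * k) * (k' * (k' + 2 * m))"
      by (simp only: m uk)
    moreover have "u * k \<noteq> 0"
      using twists_nonzero[of u r] p(1) nz(1) by (simp add: smat_params_def)
    ultimately have "k * (k + 2 * m) = k' * (k' + 2 * m)"
      by (metis mult_left_cancel)
    then have "2 * m * (k - k') = 0"
      using kk by algebra
    then have k: "k = k'"
      using two nz(2) by (simp add: mult_eq_0_iff)
    then have "u = u'"
      using uk nz(1) by (metis mult_right_cancel)
    then show ?thesis
      by (simp only: 4 m k)
  qed
qed

section \<open>Automorphisms\<close>

declare split_paired_All [simp del] split_paired_Ex [simp del]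

type_synonym 'a heis = "'a vec3 \<times> 'a vec3 \<times> 'a vec3"

definition gmul :: "'a::comm_ring_1 \<Rightarrow> 'a \<Rightarrow> 'a heis \<Rightarrow> 'a heis \<Rightarrow> 'a heis" where
  "gmul r s = (\<lambda>(u, w, t) (u', w', t'). (u + u', w + w', t + t' + frm r s u w'))"

lemma gmul_simps [simp]:
  "gmul r s (u, w, t) (u', w', t') = (u + u', w + w', t + t' + frm r s u w')"
  by (simp add: gmul_def)

definition autos :: "'a::comm_ring_1 \<Rightarrow> 'a \<Rightarrow> ('a heis \<Rightarrow> 'a heis) set" where
  "autos r s = {f. bij f \<and> (\<forall>x y. f (gmul r s x y) = gmul r s (f x) (f y))}"

lemma autosD:
  assumes "f \<in> autos r s"
  shows "bij f" "f (gmul r s x y) = gmul r s (f x) (f y)"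
  using assms by (auto simp: autos_def)

lemma autos_comp: "f \<in> autos r s \<Longrightarrow> g \<in> autos r s \<Longrightarrow> f \<circ> g \<in> autos r s"
  by (simp add: autos_def bij_comp)

lemma autos_inv:
  assumes "f \<in> autos r s"
  shows "inv_into UNIV f \<in> autos r s"
proof -
  have "inv_into UNIV f (gmul r s x y) = gmul r s (inv_into UNIV f x) (inv_into UNIV f y)" for x y
    using autosD[OF assms] by (metis bij_inv_eq_iff)
  then show ?thesis
    using autosD(1)[OF assms] by (simp add: autos_def bij_imp_bij_inv)
qed

text \<open>The commutator of \<^term>\<open>(u, w)\<close> and \<^term>\<open>(u', w')\<close>.\<close>

definition cform :: "'a::comm_ring_1 \<Rightarrow> 'a \<Rightarrow> 'a vec3 \<times> 'a vec3 \<Rightarrow> 'a vec3 \<times> 'a vec3 \<Rightarrow> 'a vec3" where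
  "cform r s = (\<lambda>(u, w) (u', w'). frm r s u w' - frm r s u' w)"

lemma cform_simps [simp]: "cform r s (u, w) (u', w') = frm r s u w' - frm r s u' w"
  by (simp add: cform_def)

lemma gmul_commute_iff:
  "gmul r s (u, w, t) (u', w', t') = gmul r s (u', w', t') (u, w, t) \<longleftrightarrow> cform r s (u, w) (u', w') = 0"
  by (auto simp: algebra_simps)

lemma gmul_commutator:
  "gmul r s (u, w, t) (u', w', t') = gmul r s (gmul r s (u', w', t') (u, w, t)) (0, 0, cform r s (u, w) (u', w'))"
  by (simp add: algebra_simps)

lemma gmul_decompose:
  "(u, w, t) = gmul r s (gmul r s (u, 0, 0) (0, w, 0)) (0, 0, t - frm r s u w)"
  by simp

text \<open>Exchanging \<open>u\<close> and \<open>w\<close> changes the sign of the commutator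
  form, so the center is negated, and \<open>frm r s u w\<close> corrects the cocycle. Composition
  with this map carries statements on the first block column of an automorphism over to the
  second.\<close>

lemma swap_autos: "(\<lambda>(u, w, t). (w, u, frm r s u w - t)) \<in> autos r s" (is "?f \<in> _")
proof -
  have "?f (?f x) = x" for x
  proof -
    obtain u w t where x: "x = (u, w, t)"
      by (cases x)
    show ?thesis
      using frm_commute[of r s u w] by (simp add: x)
  qed
  then have "bij ?f"
    by (rule involuntory_imp_bij)
  moreover have "?f (gmul r s x y) = gmul r s (?f x) (?f y)" for x y
  proof -
    obtain u w t u' w' t' where xy: "x = (u, w, t)" "y = (u', w', t')"
      by (metis prod_cases3)
    show ?thesis
      by (simp add: xy frm_add_left frm_add_right frm_commute[of r s w u'])
  qed
  ultimately show ?thesis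
    by (simp add: autos_def)
qed

text \<open>\<open>s_nonzero\<close> makes self-adjoint operators scalar, \<open>disc\<close> keeps
  the matrices \<open>smat\<close> invertible, and \<open>prime_field\<close> turns additive maps
  into linear ones.\<close>

locale prime_form =
  fixes r s :: "'a::{field,finite}"
  assumes two: "(2::'a) \<noteq> 0" and s_nonzero: "s \<noteq> 0" and disc: "r\<^sup>2 \<noteq> 4 * s"
    and prime_field: "\<And>x::'a. \<exists>n. x = of_nat n"
begin

abbreviation \<phi> :: "'a vec3 \<Rightarrow> 'a vec3 \<Rightarrow> 'a vec3" where "\<phi> \<equiv> frm r s"

abbreviation mul (infixl "\<star>" 70) where "x \<star> y \<equiv> gmul r s x y"

abbreviation cf :: "'a vec3 \<times> 'a vec3 \<Rightarrow> 'a vec3 \<times> 'a vec3 \<Rightarrow> 'a vec3" where "cf \<equiv> cform r s"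

section \<open>The center and the block form of an automorphism\<close>

lemma cform_nondegenerate:
  assumes "\<And>y. cf x y = 0"
  shows "x = 0"
proof -
  obtain u w where x: "x = (u, w)"
    by (cases x)
  have "\<phi> u y = 0" for y
    using assms[of "(0, y)"] by (simp add: x)
  moreover have "\<phi> w y = 0" for y
    using assms[of "(y, 0)"] by (simp add: x frm_commute)
  ultimately show ?thesis
    using frm_nondegenerate x by (metis zero_prod_def)
qed

lemma additive_lin:
  fixes f :: "'a vec3 \<Rightarrow> 'a vec3"
  assumes "\<And>x y. f (x + y) = f x + f y"
  obtains M where "f = lin M"
  using additive_eq_lin[of f] prime_field assms by metis

lemma center_iff: "(\<forall>y. (u, w, t) \<star> y = y \<star> (u, w, t)) \<longleftrightarrow> u = 0 \<and> w = 0"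
proof
  assume "\<forall>y. (u, w, t) \<star> y = y \<star> (u, w, t)"
  then have "cf (u, w) y = 0" for y
    using gmul_commute_iff by (metis surj_pair)
  then show "u = 0 \<and> w = 0"
    using cform_nondegenerate[of "(u, w)"] by (simp add: zero_prod_def)
next
  assume "u = 0 \<and> w = 0"
  moreover have "(0, 0, t) \<star> (u', w', t') = (u', w', t') \<star> (0, 0, t)" for u' w' t'
    by (simp add: add.commute)
  ultimately show "\<forall>y. (u, w, t) \<star> y = y \<star> (u, w, t)"
    by (metis prod_cases3)
qed

lemma autos_center_iff:
  assumes f: "f \<in> autos r s" and fx: "f (u, w, t) = (u', w', t')"
  shows "u' = 0 \<and> w' = 0 \<longleftrightarrow> u = 0 \<and> w = 0"
proof -
  have "(\<forall>y. (u', w', t') \<star> y = y \<star> (u', w', t')) \<longleftrightarrow> (\<forall>y. f (u, w, t) \<star> f y = f y \<star> f (u, w, t))"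
    unfolding fx using autosD(1)[OF f] by (metis bij_pointE)
  also have "\<dots> \<longleftrightarrow> (\<forall>y. (u, w, t) \<star> y = y \<star> (u, w, t))"
    using autosD[OF f] by (metis bij_is_inj injD)
  finally show ?thesis
    unfolding center_iff .
qed

text \<open>Modulo the center, an automorphism is a linear map of \<^term>\<open>(u, w)\<close> with blocks
  \<^term>\<open>A\<close>, \<^term>\<open>B\<close>, \<^term>\<open>C\<close>, \<^term>\<open>D\<close>.\<close>

definition blocks :: "('a heis \<Rightarrow> 'a heis) \<Rightarrow> 'a mat3 \<Rightarrow> 'a mat3 \<Rightarrow> 'a mat3 \<Rightarrow> 'a mat3 \<Rightarrow> 'a mat3 \<Rightarrow> bool" where
  "blocks f A B C D N \<longleftrightarrow>
     (\<forall>u w t. \<exists>t'. f (u, w, t) = (lin A u + lin B w, lin C u + lin D w, t')) \<and>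
     (\<forall>t. f (0, 0, t) = (0, 0, lin N t)) \<and>
     (\<forall>u w u' w'. cf (lin A u + lin B w, lin C u + lin D w) (lin A u' + lin B w', lin C u' + lin D w')
        = lin N (cf (u, w) (u', w')))"

text \<open>The first two components of \<open>f\<close> are homomorphisms into additive groups and
  vanish on the center, which \<open>f\<close> preserves; so they are sums of additive, hence
  linear, maps of \<open>u\<close> and of \<open>w\<close>.\<close>

lemma autos_blocks:
  assumes f: "f \<in> autos r s"
  obtains A B C D N where "blocks f A B C D N"
proof -
  define p q z where "p = (\<lambda>x. fst (f x))" and "q = (\<lambda>x. fst (snd (f x)))" and "z = (\<lambda>x. snd (snd (f x)))"
  have fpq: "f x = (p x, q x, z x)" for x
    by (simp add: p_def q_def z_def)
  have mul: "p (x \<star> y) = p x + p y" "q (x \<star> y) = q x + q y"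
    "z (x \<star> y) = z x + z y + \<phi> (p x) (q y)" for x y
    using autosD(2)[OF f, of x y] by (simp_all add: fpq)
  have center: "p (0, 0, t) = 0" "q (0, 0, t) = 0" for t
    using autos_center_iff[OF f fpq[of "(0, 0, t)"]] by auto
  have u_mul: "(u + u', 0, 0) = (u, 0, 0) \<star> (u', 0, 0)" and w_mul: "(0, w + w', 0) = (0, w, 0) \<star> (0, w', 0)"
    and t_mul: "(0, 0, t + t') = (0, 0, t) \<star> (0, 0, t')" for u u' w w' t t'
    by simp_all
  obtain A where A: "(\<lambda>u. p (u, 0, 0)) = lin A"
    by (rule additive_lin[of "\<lambda>u. p (u, 0, 0)"]) (simp_all only: u_mul mul)
  obtain B where B: "(\<lambda>w. p (0, w, 0)) = lin B"
    by (rule additive_lin[of "\<lambda>w. p (0, w, 0)"]) (simp_all only: w_mul mul)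
  obtain C where C: "(\<lambda>u. q (u, 0, 0)) = lin C"
    by (rule additive_lin[of "\<lambda>u. q (u, 0, 0)"]) (simp_all only: u_mul mul)
  obtain D where D: "(\<lambda>w. q (0, w, 0)) = lin D"
    by (rule additive_lin[of "\<lambda>w. q (0, w, 0)"]) (simp_all only: w_mul mul)
  obtain N where N: "(\<lambda>t. z (0, 0, t)) = lin N"
    by (rule additive_lin[of "\<lambda>t. z (0, 0, t)"]) (simp_all only: t_mul mul center, simp)
  have p: "p (u, w, t) = lin A u + lin B w" and q: "q (u, w, t) = lin C u + lin D w" for u w t
    unfolding gmul_decompose[of u w t r s] mul center
    by (simp_all add: fun_cong[OF A, symmetric] fun_cong[OF B, symmetric] fun_cong[OF C, symmetric]
        fun_cong[OF D, symmetric])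
  \<comment> \<open>This is \<open>f\<close> applied to the identity
    \<open>x y = y x [x, y]\<close>, whose commutator is central.\<close>
  have c: "cf (p x, q x) (p y, q y) = lin N (cf (fst x, fst (snd x)) (fst y, fst (snd y)))" for x y
  proof -
    obtain u w t u' w' t' where xy: "x = (u, w, t)" "y = (u', w', t')"
      by (metis prod_cases3)
    have "f x \<star> f y = f y \<star> f x \<star> f (0, 0, cf (u, w) (u', w'))"
      unfolding autosD(2)[OF f, symmetric] xy by (simp only: gmul_commutator[of r s u w t u' w' t'])
    then show ?thesis
      by (simp add: fpq center xy fun_cong[OF N, symmetric] algebra_simps)
  qed
  have "blocks f A B C D N"
    unfolding blocks_def
  proof (intro conjI allI)
    show "\<exists>t'. f (u, w, t) = (lin A u + lin B w, lin C u + lin D w, t')" for u w t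
      by (simp add: fpq p q)
    show "f (0, 0, t) = (0, 0, lin N t)" for t
      by (simp add: fpq center fun_cong[OF N, symmetric])
    show "cf (lin A u + lin B w, lin C u + lin D w) (lin A u' + lin B w', lin C u' + lin D w')
        = lin N (cf (u, w) (u', w'))" for u w u' w'
      using c[of "(u, w, 0)" "(u', w', 0)"] by (simp add: p q)
  qed
  then show thesis
    by (rule that)
qed

lemma blocksD:
  assumes "blocks f A B C D N"
  shows "\<exists>t'. f (u, w, t) = (lin A u + lin B w, lin C u + lin D w, t')"
    "f (0, 0, t) = (0, 0, lin N t)"
    "cf (lin A u + lin B w, lin C u + lin D w) (lin A u' + lin B w', lin C u' + lin D w')
        = lin N (cf (u, w) (u', w'))"
  using assms unfolding blocks_def by blast+

section \<open>The tensor structure of an automorphism modulo the center\<close>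

lemma scalar_if_self_adjoint:
  fixes F :: "'a vec3 \<Rightarrow> 'a vec3"
  assumes "\<And>x y. F (x + y) = F x + F y" "\<And>x y. G (x + y) = G x + G y"
    and "\<And>x y. \<phi> (F x) y = \<phi> x (G y)"
  obtains k where "\<And>x. F x = scal k x" "\<And>x. G x = scal k x"
  using frm_adjoint_imp_scalar[OF two s_nonzero] assms additive_lin[of F] additive_lin[of G] by metis

text \<open>Conjugating the nilpotent map \<open>(u, w) \<mapsto> (w, 0)\<close>, which is skew-adjoint for the commutator
  form, by an automorphism gives a skew-adjoint map again. Its blocks are then self-adjoint for
  \<open>\<phi>\<close>, hence scalars; comparing matrix entries yields linear relations between the blocks of the
  automorphism.\<close>

lemma blocks_relations:
  assumes f: "f \<in> autos r s" and bl: "blocks f A B C D N"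
  obtains l q k where "\<And>w. lin A w = scal l (lin B w) + scal q (lin D w)"
    "\<And>w. lin C w = scal k (lin B w) - scal l (lin D w)"
    "\<And>u. scal l (lin A u) + scal q (lin C u) = 0"
    "\<And>u. scal k (lin A u) = scal l (lin C u)"
proof -
  obtain A' B' C' D' N' where bl': "blocks (inv_into UNIV f) A' B' C' D' N'"
    using autos_blocks autos_inv[OF f] by metis
  have right: "lin A (lin A' u + lin B' w) + lin B (lin C' u + lin D' w) = u"
    "lin C (lin A' u + lin B' w) + lin D (lin C' u + lin D' w) = w" for u w
  proof -
    obtain t where t: "inv_into UNIV f (u, w, 0) = (lin A' u + lin B' w, lin C' u + lin D' w, t)"
      using blocksD(1)[OF bl'] by metis
    have "f (inv_into UNIV f (u, w, 0)) = (u, w, 0)"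
      using autosD(1)[OF f] by (metis bij_inv_eq_iff)
    then show "lin A (lin A' u + lin B' w) + lin B (lin C' u + lin D' w) = u"
      "lin C (lin A' u + lin B' w) + lin D (lin C' u + lin D' w) = w"
      using blocksD(1)[OF bl, of "lin A' u + lin B' w" "lin C' u + lin D' w" t] unfolding t by auto
  qed
  have left: "lin A' (lin A u + lin B w) + lin B' (lin C u + lin D w) = u"
    "lin C' (lin A u + lin B w) + lin D' (lin C u + lin D w) = w" for u w
  proof -
    obtain t where t: "f (u, w, 0) = (lin A u + lin B w, lin C u + lin D w, t)"
      using blocksD(1)[OF bl] by metis
    have "inv_into UNIV f (f (u, w, 0)) = (u, w, 0)"
      using autosD(1)[OF f] by (metis bij_inv_eq_iff)
    then show "lin A' (lin A u + lin B w) + lin B' (lin C u + lin D w) = u"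
      "lin C' (lin A u + lin B w) + lin D' (lin C u + lin D w) = w"
      using blocksD(1)[OF bl', of "lin A u + lin B w" "lin C u + lin D w" t] unfolding t by auto
  qed
  \<comment> \<open>The conjugate of the nilpotent map: apply the inverse of \<open>f\<close>, move
    the second component to the first place, apply \<open>f\<close>.\<close>
  define X where "X = (\<lambda>(u, w). (lin A (lin C' u + lin D' w), lin C (lin C' u + lin D' w)))"
  \<comment> \<open>Pulled back by \<open>f\<close>, both sides become \<open>\<phi> b b'\<close>,
    up to \<open>N\<close>; the symmetry of \<phi> is what makes \<open>X\<close>
    skew-adjoint.\<close>
  have skew: "cf (X v) v' = - cf v (X v')" for v v'
  proof -
    obtain u w u' w' where v: "v = (u, w)" "v' = (u', w')"
      by (metis surj_pair)
    define a b a' b' where ab: "a = lin A' u + lin B' w" "b = lin C' u + lin D' w"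
      "a' = lin A' u' + lin B' w'" "b' = lin C' u' + lin D' w'"
    have vs: "v = (lin A a + lin B b, lin C a + lin D b)" "v' = (lin A a' + lin B b', lin C a' + lin D b')"
      unfolding v ab right by simp_all
    have Xs: "X v = (lin A b + lin B 0, lin C b + lin D 0)" "X v' = (lin A b' + lin B 0, lin C b' + lin D 0)"
      unfolding v X_def ab by simp_all
    show ?thesis
      unfolding Xs unfolding vs blocksD(3)[OF bl] lin_minus[symmetric] by (simp add: frm_commute)
  qed
  have skew_form: "\<phi> (lin A (lin C' u + lin D' w)) w' - \<phi> u' (lin C (lin C' u + lin D' w)) =
      - (\<phi> u (lin C (lin C' u' + lin D' w')) - \<phi> (lin A (lin C' u' + lin D' w')) w)" for u w u' w'
    using skew[of "(u, w)" "(u', w')"] by (simp add: X_def)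
  obtain l where P: "\<And>x. lin A (lin C' x) = scal l x" and S: "\<And>x. - lin C (lin D' x) = scal l x"
  proof (rule scalar_if_self_adjoint)
    show "\<phi> (lin A (lin C' x)) y = \<phi> x (- lin C (lin D' y))" for x y
      using skew_form[of x 0 y 0] by (simp add: frm_minus_right)
  qed (simp_all add: lin_add)
  obtain k where R: "\<And>x. lin C (lin C' x) = scal k x"
  proof (rule scalar_if_self_adjoint)
    show "\<phi> (lin C (lin C' x)) y = \<phi> x (lin C (lin C' y))" for x y
      using skew_form[of x 0 0 y] by (simp add: frm_commute)
  qed (simp_all add: lin_add)
  obtain q where Q: "\<And>x. lin A (lin D' x) = scal q x"
  proof (rule scalar_if_self_adjoint)
    show "\<phi> (lin A (lin D' x)) y = \<phi> x (lin A (lin D' y))" for x y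
      using skew_form[of 0 x y 0] by (simp add: frm_commute)
  qed (simp_all add: lin_add)
  have S': "lin C (lin D' x) = - scal l x" for x
    using S[of x] by (simp add: minus_equation_iff)
  \<comment> \<open>Each relation is the second row of the left inverse,
    \<open>C' (A u + B w) + D' (C u + D w) = w\<close>, with \<open>A\<close> or \<open>C\<close>
    applied to it and the products with \<open>C'\<close> and \<open>D'\<close> replaced by
    scalars.\<close>
  show thesis
  proof (rule that)
    show "lin A w = scal l (lin B w) + scal q (lin D w)" for w
      using arg_cong[OF left(2)[of 0 w], of "lin A"] by (simp add: lin_add P Q)
    show "lin C w = scal k (lin B w) - scal l (lin D w)" for w
      using arg_cong[OF left(2)[of 0 w], of "lin C"] by (simp add: lin_add R S')
    show "scal l (lin A u) + scal q (lin C u) = 0" for u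
      using arg_cong[OF left(2)[of u 0], of "lin A"] by (simp add: lin_add P Q)
    show "scal k (lin A u) = scal l (lin C u)" for u
      using arg_cong[OF left(2)[of u 0], of "lin C"] by (simp add: lin_add R S')
  qed
qed

lemma blocks_kernel:
  assumes f: "f \<in> autos r s" and bl: "blocks f A B C D N"
    and "lin A u + lin B w = 0" "lin C u + lin D w = 0"
  shows "u = 0" "w = 0"
proof -
  obtain t' where "f (u, w, 0) = (lin A u + lin B w, lin C u + lin D w, t')"
    using blocksD(1)[OF bl] by metis
  from autos_center_iff[OF f this] show "u = 0" "w = 0"
    using assms(3,4) by auto
qed

text \<open>The first block column is killed by the scalar matrix with rows \<open>(l, q)\<close>
  and \<open>(k, - l)\<close>, so any nonzero entry makes \<open>A\<close> and \<open>C\<close>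
  proportional. If all entries were zero, \<open>A\<close> and \<open>C\<close> would vanish and
  \<open>f\<close> would send noncentral elements into the center.\<close>

lemma blocks_proportional:
  assumes f: "f \<in> autos r s" and bl: "blocks f A B C D N"
  obtains h a c where "\<And>u. lin A u = scal a (lin h u)" "\<And>u. lin C u = scal c (lin h u)"
proof -
  obtain l q k where rel: "\<And>w. lin A w = scal l (lin B w) + scal q (lin D w)"
    "\<And>w. lin C w = scal k (lin B w) - scal l (lin D w)"
    "\<And>u. scal l (lin A u) + scal q (lin C u) = 0"
    "\<And>u. scal k (lin A u) = scal l (lin C u)"
    using blocks_relations[OF f bl] by blast
  consider "l \<noteq> 0" | "l = 0" "q \<noteq> 0" | "l = 0" "q = 0" "k \<noteq> 0" | "l = 0" "q = 0" "k = 0"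
    by blast
  then show thesis
  proof cases
    case 1
    have "lin A u = scal (- q / l) (lin C u)" for u
    proof -
      have "scal (1 / l) (scal l (lin A u) + scal q (lin C u)) = 0"
        by (simp only: rel(3) scal_0)
      then have "lin A u + scal (q / l) (lin C u) = 0"
        using 1 by (simp add: scal_add scal_scal)
      then show ?thesis
        by (simp add: eq_neg_iff_add_eq_0 scal_def prod_eq_iff)
    qed
    then show thesis
      by (intro that[of "- q / l" C 1]) simp_all
  next
    case 2
    then have "lin C u = 0" for u
      using rel(3)[of u] by (simp add: scal_eq_0_iff)
    then show thesis
      by (intro that[of 1 A 0]) simp_all
  next
    case 3
    then have "lin A u = 0" for u
      using rel(4)[of u] by (simp add: scal_eq_0_iff)
    then show thesis
      by (intro that[of 0 C 1]) simp_all
  next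
    case 4
    then have "lin A (1, 0, 0) + lin B 0 = 0" "lin C (1, 0, 0) + lin D 0 = 0"
      using rel(1,2) by (simp_all del: lin_simps)
    then have "(1, 0, 0) = (0 :: 'a vec3)"
      by (rule blocks_kernel(1)[OF f bl])
    then show thesis
      by (simp add: zero_prod_def)
  qed
qed
end

section \<open>Explicit automorphisms, and why there are no others\<close>

definition gl2 :: "('a::comm_ring_1 \<times> 'a \<times> 'a \<times> 'a) set" where
  "gl2 = {(a, b, c, d). a * d - b * c \<noteq> 0}"

context prime_form
begin

text \<open>The quadratic terms correct the cocycle: up to the multiplier, the third component must
  deviate from additivity by \<open>\<phi> (a u + b w) (c u' + d w')\<close>. The terms in
  \<open>\<phi> u u\<close> and \<open>\<phi> w w\<close> polarise to the parts with
  \<open>a c\<close> and \<open>b d\<close>; \<open>b c\<close> times \<open>\<phi> u w\<close>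
  yields the part with \<open>\<phi> u' w\<close>, and the determinant raises the coefficient of
  \<open>\<phi> u w'\<close> from \<open>b c\<close> to \<open>a d\<close>.\<close>

definition aut_param :: "'a \<times> 'a \<times> 'a \<times> 'a \<Rightarrow> 'a mat3 \<Rightarrow> 'a mat3 \<Rightarrow> 'a mat3 \<Rightarrow> 'a heis \<Rightarrow> 'a heis" where
  "aut_param = (\<lambda>(a, b, c, d) h L1 L2 (u, w, t).
     (lin h (scal a u + scal b w), lin h (scal c u + scal d w),
      lin (multiplier r s h) (scal (a * d - b * c) t + scal (a * c / 2) (\<phi> u u) + scal (b * c) (\<phi> u w)
        + scal (b * d / 2) (\<phi> w w)) + lin L1 u + lin L2 w))"

lemma aut_param_simps [simp]:
  "aut_param (a, b, c, d) h L1 L2 (u, w, t) =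
     (lin h (scal a u + scal b w), lin h (scal c u + scal d w),
      lin (multiplier r s h) (scal (a * d - b * c) t + scal (a * c / 2) (\<phi> u u) + scal (b * c) (\<phi> u w)
        + scal (b * d / 2) (\<phi> w w)) + lin L1 u + lin L2 w)"
  by (simp add: aut_param_def)

lemma aut_param_gmul:
  assumes h: "similitude r s h"
  shows "aut_param g h L1 L2 (x \<star> y) = aut_param g h L1 L2 x \<star> aut_param g h L1 L2 y"
proof -
  obtain a b c d where g: "g = (a, b, c, d)"
    by (metis prod_cases4)
  obtain u w t u' w' t' where xy: "x = (u, w, t)" "y = (u', w', t')"
    by (metis prod_cases3)
  have key: "scal (a * d - b * c) (t + t' + \<phi> u w') + scal (a * c / 2) (\<phi> (u + u') (u + u'))
      + scal (b * c) (\<phi> (u + u') (w + w')) + scal (b * d / 2) (\<phi> (w + w') (w + w')) =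
    (scal (a * d - b * c) t + scal (a * c / 2) (\<phi> u u) + scal (b * c) (\<phi> u w) + scal (b * d / 2) (\<phi> w w))
    + (scal (a * d - b * c) t' + scal (a * c / 2) (\<phi> u' u') + scal (b * c) (\<phi> u' w') + scal (b * d / 2) (\<phi> w' w'))
    + \<phi> (scal a u + scal b w) (scal c u' + scal d w')"
    unfolding frm_bilinear frm_commute[of r s u' u] frm_commute[of r s w' w] frm_commute[of r s w u']
    using two four_nonzero[OF two] by (simp add: scal_def prod_eq_iff field_simps)
  show ?thesis
    unfolding g xy gmul_simps aut_param_simps key similitude_frm[OF h]
    by (simp add: lin_add scal_add algebra_simps)
qed

lemma frm_spans:
  fixes F G :: "'a vec3 \<Rightarrow> 'a vec3"
  assumes "\<And>x y. F (x + y) = F x + F y" "\<And>x y. G (x + y) = G x + G y"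
    and "\<And>x y. F (\<phi> x y) = G (\<phi> x y)"
  shows "F t = G t"
proof -
  obtain t1 t2 t3 where t: "t = (t1, t2, t3)"
    by (cases t)
  have "t = \<phi> (t1, 0, 0) (0, 0, 1) + \<phi> (t2, 0, 0) (0, 1, 0) + \<phi> (0, 0, t3) (0, 0, 1)"
    by (simp add: t)
  then show ?thesis
    by (metis assms)
qed

text \<open>The values of \<phi> span the center, and since \<open>h\<close> is onto, each of them
  lies in the range of the multiplier. On a finite space a surjective map is injective.\<close>

lemma multiplier_inj:
  assumes h: "similitude r s h" and inj: "inj (lin h)"
  shows "inj (lin (multiplier r s h))"
proof -
  have surj: "surj (lin h)"
    using inj by (simp add: finite_UNIV_inj_surj)
  have "t \<in> range (lin (multiplier r s h))" for t
  proof -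
    have phi: "\<exists>z. \<phi> x y = lin (multiplier r s h) z" for x y
    proof -
      obtain x' y' where "x = lin h x'" "y = lin h y'"
        using surj by blast
      then show ?thesis
        using similitude_frm[OF h] by blast
    qed
    obtain t1 t2 t3 where t: "t = (t1, t2, t3)"
      by (cases t)
    have "t = \<phi> (t1, 0, 0) (0, 0, 1) + \<phi> (t2, 0, 0) (0, 1, 0) + \<phi> (0, 0, t3) (0, 0, 1)"
      by (simp add: t)
    moreover obtain z1 z2 z3 where "\<phi> (t1, 0, 0) (0, 0, 1) = lin (multiplier r s h) z1"
      "\<phi> (t2, 0, 0) (0, 1, 0) = lin (multiplier r s h) z2"
      "\<phi> (0, 0, t3) (0, 0, 1) = lin (multiplier r s h) z3"
      using phi by blast
    ultimately have "t = lin (multiplier r s h) (z1 + z2 + z3)"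
      by (simp only: lin_add)
    then show ?thesis
      by (rule range_eqI)
  qed
  then have "surj (lin (multiplier r s h))"
    by blast
  then show ?thesis
    by (simp add: finite_UNIV_surj_inj)
qed

lemma gl2_inj:
  fixes u w :: "'a vec3"
  assumes "a * d - b * c \<noteq> 0" and "scal a u + scal b w = scal a u' + scal b w'"
    and "scal c u + scal d w = scal c u' + scal d w'"
  shows "u = u'" "w = w'"
proof -
  have solve: "x = x' \<and> y = y'" if "a * x + b * y = a * x' + b * y'" "c * x + d * y = c * x' + d * y'"
    for x y x' y' :: 'a
  proof -
    have "(a * d - b * c) * (x - x') = 0"
      using that by algebra
    moreover have "(a * d - b * c) * (y - y') = 0"
      using that by algebra
    ultimately show ?thesis
      using assms(1) by simp
  qed
  show "u = u'" "w = w'"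
    using solve[of "fst u" "fst w" "fst u'" "fst w'"]
      solve[of "fst (snd u)" "fst (snd w)" "fst (snd u')" "fst (snd w')"]
      solve[of "snd (snd u)" "snd (snd w)" "snd (snd u')" "snd (snd w')"] assms(2,3)
    by (simp_all add: scal_def prod_eq_iff)
qed

lemma aut_param_autos:
  assumes g: "g \<in> gl2" and h: "similitude r s h" and inj: "inj (lin h)"
  shows "aut_param g h L1 L2 \<in> autos r s"
proof -
  obtain a b c d where g_eq: "g = (a, b, c, d)"
    by (metis prod_cases4)
  have det: "a * d - b * c \<noteq> 0"
    using g by (simp add: gl2_def g_eq)
  have "inj (aut_param g h L1 L2)"
  proof (rule injI)
    fix x y
    assume eq: "aut_param g h L1 L2 x = aut_param g h L1 L2 y"
    obtain u w t u' w' t' where xy: "x = (u, w, t)" "y = (u', w', t')"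
      by (metis prod_cases3)
    have "lin h (scal a u + scal b w) = lin h (scal a u' + scal b w')"
      "lin h (scal c u + scal d w) = lin h (scal c u' + scal d w')"
      using eq by (simp_all add: g_eq xy)
    then have "scal a u + scal b w = scal a u' + scal b w'" "scal c u + scal d w = scal c u' + scal d w'"
      by (simp_all only: inj_eq[OF inj])
    note uw = gl2_inj[OF det this]
    have "lin (multiplier r s h) (scal (a * d - b * c) t) = lin (multiplier r s h) (scal (a * d - b * c) t')"
      using eq by (simp add: g_eq xy uw lin_add)
    then have "scal (a * d - b * c) t = scal (a * d - b * c) t'"
      by (simp only: inj_eq[OF multiplier_inj[OF h inj]])
    then have "t = t'"
      using det by (simp add: scal_def prod_eq_iff)
    then show "x = y"
      by (simp add: xy uw)
  qed
  then have "bij (aut_param g h L1 L2)"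
    by (simp add: bij_def finite_UNIV_inj_surj)
  then show ?thesis
    using aut_param_gmul[OF h] by (simp add: autos_def)
qed

lemma smat_params_similitude:
  assumes "(u, q) \<in> smat_params r s"
  shows "similitude r s (smat u q)" "inj (lin (smat u q))"
  using assms similitude_smat[of u r q s] inj_smat[OF two s_nonzero disc, of u q]
  by (auto simp: smat_params_def)

text \<open>Precomposition with the swap makes \<open>B\<close> and \<open>D\<close> a first block
  column, hence proportional to one \<open>h\<close>. As \<open>A\<close> and \<open>C\<close> are
  combinations of \<open>B\<close> and \<open>D\<close>, the same \<open>h\<close> serves all four
  blocks.\<close>

lemma autos_tensor:
  assumes f: "f \<in> autos r s" and bl: "blocks f A B C D N"
  obtains a b c d h where "\<And>x. lin A x = scal a (lin h x)" "\<And>x. lin B x = scal b (lin h x)"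
    "\<And>x. lin C x = scal c (lin h x)" "\<And>x. lin D x = scal d (lin h x)"
proof -
  define \<sigma> where "\<sigma> = (\<lambda>(u, w, t). (w, u, \<phi> u w - t))"
  have fs: "f \<circ> \<sigma> \<in> autos r s"
    unfolding \<sigma>_def using f swap_autos by (rule autos_comp)
  obtain A' B' C' D' N' where bl': "blocks (f \<circ> \<sigma>) A' B' C' D' N'"
    using autos_blocks[OF fs] by blast
  have A': "lin A' x = lin B x" and C': "lin C' x = lin D x" for x
  proof -
    obtain t1 t2 where "(f \<circ> \<sigma>) (x, 0, 0) = (lin A' x + lin B' 0, lin C' x + lin D' 0, t1)"
      "f (0, x, 0) = (lin A 0 + lin B x, lin C 0 + lin D x, t2)"
      using blocksD(1)[OF bl'] blocksD(1)[OF bl] by metis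
    then show "lin A' x = lin B x" "lin C' x = lin D x"
      by (simp_all add: \<sigma>_def)
  qed
  obtain h b d where h: "\<And>x. lin A' x = scal b (lin h x)" "\<And>x. lin C' x = scal d (lin h x)"
    by (rule blocks_proportional[OF fs bl']) (rule that)
  obtain l q k where rel: "\<And>w. lin A w = scal l (lin B w) + scal q (lin D w)"
    "\<And>w. lin C w = scal k (lin B w) - scal l (lin D w)"
    by (rule blocks_relations[OF f bl]) (rule that)
  show thesis
  proof (rule that)
    show B: "lin B x = scal b (lin h x)" and D: "lin D x = scal d (lin h x)" for x
      using h A' C' by simp_all
    show "lin A x = scal (l * b + q * d) (lin h x)" for x
      by (simp add: rel B D scal_scal scal_add_left)
    show "lin C x = scal (k * b - l * d) (lin h x)" for x
      unfolding rel B D by (simp add: scal_def algebra_simps)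
  qed
qed

text \<open>The automorphism \<open>f0\<close> built from \<open>g\<close> and the similitude alone
  agrees with \<open>f\<close> modulo the center and on the center. The third components then differ
  by an additive map that vanishes on the center, which is what \<open>L1\<close> and
  \<open>L2\<close> record.\<close>

lemma autos_eq_aut_param:
  assumes f: "f \<in> autos r s"
  shows "\<exists>g \<in> gl2. \<exists>(u, q) \<in> smat_params r s. \<exists>L1 L2. f = aut_param g (smat u q) L1 L2"
proof -
  obtain A B C D N where bl: "blocks f A B C D N"
    using autos_blocks[OF f] by blast
  obtain a b c d h where h: "\<And>x. lin A x = scal a (lin h x)" "\<And>x. lin B x = scal b (lin h x)"
    "\<And>x. lin C x = scal c (lin h x)" "\<And>x. lin D x = scal d (lin h x)"
    by (rule autos_tensor[OF f bl]) (rule that)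
  have form: "lin N (\<phi> x y) = scal (a * d - b * c) (\<phi> (lin h x) (lin h y))" for x y
  proof -
    have "lin N (\<phi> x y) = \<phi> (scal a (lin h x)) (scal d (lin h y)) - \<phi> (scal b (lin h y)) (scal c (lin h x))"
      using blocksD(3)[OF bl, of x 0 0 y] by (simp add: h)
    also have "\<dots> = scal (a * d) (\<phi> (lin h x) (lin h y)) - scal (b * c) (\<phi> (lin h x) (lin h y))"
      by (simp add: frm_scal_left frm_scal_right scal_scal mult.commute frm_commute[of r s "lin h y"])
    finally show ?thesis
      by (simp only: scal_diff_left)
  qed
  have det: "a * d - b * c \<noteq> 0"
  proof
    assume "a * d - b * c = 0"
    then have "lin N (1, 0, 0) = lin N 0"
      using form[of "(1, 0, 0)" "(0, 0, 1)"] by (simp del: lin_simps)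
    then have "f (0, 0, (1, 0, 0)) = f (0, 0, 0)"
      unfolding blocksD(2)[OF bl] by simp
    then show False
      using autosD(1)[OF f] by (simp add: bij_is_inj inj_eq zero_prod_def)
  qed
  have h_zero: "x = 0" if "lin h x = 0" for x
    by (rule blocks_kernel(1)[OF f bl, of x 0]) (simp_all add: h that)
  have inj: "inj (lin h)"
  proof (rule injI)
    fix x y
    assume "lin h x = lin h y"
    then have "lin h (x - y) = 0"
      by (simp add: lin_diff)
    then show "x = y"
      using h_zero[of "x - y"] by simp
  qed
  \<comment> \<open>By \<open>form\<close>, the map \<open>N\<close> divided by the determinant is a
    multiplier for \<open>h\<close>.\<close>
  obtain N' where N': "(\<lambda>x. scal (1 / (a * d - b * c)) (lin N x)) = lin N'"
    by (rule additive_lin[of "\<lambda>x. scal (1 / (a * d - b * c)) (lin N x)"]) (simp add: lin_add scal_add, blast)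
  have "\<phi> (lin h x) (lin h y) = lin N' (\<phi> x y)" for x y
    unfolding fun_cong[OF N', symmetric] form using det by (simp add: scal_scal)
  then have sim: "similitude r s h"
    by (rule similitudeI)
  have "bij (lin h)"
    using inj by (simp add: bij_def finite_UNIV_inj_surj)
  then obtain l u q where l: "l \<noteq> 0" and uq: "(u, q) \<in> smat_params r s"
    and h_smat: "\<And>x. lin h x = scal l (lin (smat u q) x)"
    using similitude_classification[OF two s_nonzero sim] by blast
  define S where "S = smat u q"
  \<comment> \<open>The scalar \<open>l\<close> between \<open>h\<close> and its normal form is
    absorbed into the 2 x 2 matrix.\<close>
  define g where "g = (a * l, b * l, c * l, d * l)"
  have g: "g \<in> gl2"
  proof -
    have "(a * l) * (d * l) - (b * l) * (c * l) = (a * d - b * c) * (l * l)"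
      by (simp add: algebra_simps)
    then show ?thesis
      using det l by (simp add: g_def gl2_def)
  qed
  note S = smat_params_similitude[OF uq, folded S_def]
  define f0 where "f0 = aut_param g S 0 0"
  have f0: "f0 \<in> autos r s"
    unfolding f0_def using g S by (rule aut_param_autos)
  have N: "lin N t = lin (multiplier r s S) (scal (a * l * (d * l) - b * l * (c * l)) t)" for t
  proof (rule frm_spans[of "lin N"])
    show "lin N (\<phi> x y) = lin (multiplier r s S) (scal (a * l * (d * l) - b * l * (c * l)) (\<phi> x y))" for x y
      unfolding form h_smat S_def[symmetric] lin_scal similitude_frm[OF S(1), symmetric] frm_bilinear
      by (simp add: scal_scal algebra_simps)
  qed (simp_all add: lin_add scal_add)
  have lin_0_left: "lin 0 x = (0 :: 'a vec3)" for x
    by (simp add: lin_def)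
  define \<delta> where "\<delta> = (\<lambda>x. snd (snd (f x)) - snd (snd (f0 x)))"
  have fst_eq: "fst (f x) = fst (f0 x)" "fst (snd (f x)) = fst (snd (f0 x))" for x
  proof -
    obtain u w t where x: "x = (u, w, t)"
      by (cases x)
    obtain t' where "f x = (lin A u + lin B w, lin C u + lin D w, t')"
      unfolding x using blocksD(1)[OF bl] by blast
    then show "fst (f x) = fst (f0 x)" "fst (snd (f x)) = fst (snd (f0 x))"
      by (simp_all add: x f0_def g_def h h_smat S_def[symmetric] lin_add lin_scal scal_scal)
  qed
  have \<delta>_mul: "\<delta> (x \<star> y) = \<delta> x + \<delta> y" for x y
  proof -
    have "snd (snd (v \<star> v')) = snd (snd v) + snd (snd v') + \<phi> (fst v) (fst (snd v'))" for v v' :: "'a heis"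
      by (simp add: gmul_def split_beta)
    then show ?thesis
      unfolding \<delta>_def autosD(2)[OF f] autosD(2)[OF f0] by (simp add: fst_eq)
  qed
  have \<delta>_center: "\<delta> (0, 0, t) = 0" for t
    unfolding \<delta>_def blocksD(2)[OF bl] by (simp add: f0_def g_def N)
  have u_mul: "(u + u', 0, 0) = (u, 0, 0) \<star> (u', 0, 0)" and w_mul: "(0, w + w', 0) = (0, w, 0) \<star> (0, w', 0)"
    for u u' w w'
    by simp_all
  obtain L1 where L1: "(\<lambda>u. \<delta> (u, 0, 0)) = lin L1"
    by (rule additive_lin[of "\<lambda>u. \<delta> (u, 0, 0)"]) (simp_all only: u_mul \<delta>_mul)
  obtain L2 where L2: "(\<lambda>w. \<delta> (0, w, 0)) = lin L2"
    by (rule additive_lin[of "\<lambda>w. \<delta> (0, w, 0)"]) (simp_all only: w_mul \<delta>_mul)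
  have \<delta>: "\<delta> (u, w, t) = lin L1 u + lin L2 w" for u w t
    unfolding gmul_decompose[of u w t r s] \<delta>_mul \<delta>_center fun_cong[OF L1] fun_cong[OF L2] by simp
  have "f x = aut_param g S L1 L2 x" for x
  proof -
    obtain u w t where x: "x = (u, w, t)"
      by (cases x)
    have "snd (snd (f x)) = snd (snd (f0 x)) + (lin L1 u + lin L2 w)"
      using \<delta>[of u w t] by (simp add: \<delta>_def x algebra_simps)
    then have "f x = (fst (f0 x), fst (snd (f0 x)), snd (snd (f0 x)) + (lin L1 u + lin L2 w))"
      by (simp add: prod_eq_iff fst_eq)
    then show ?thesis
      by (simp add: x f0_def g_def lin_0_left add.assoc)
  qed
  then have "f = aut_param g (smat u q) L1 L2"
    unfolding S_def by blast
  then show ?thesis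
    by (intro bexI[OF _ g] bexI[OF _ uq]) auto
qed
end

section \<open>Uniqueness of the parameters and the count\<close>

lemma card_UNIV_prod: "card (UNIV :: ('a \<times> 'b) set) = card (UNIV :: 'a set) * card (UNIV :: 'b set)"
  by (metis UNIV_Times_UNIV card_cartesian_product)

context prime_form
begin

text \<open>The entries of \<open>g\<close> appear as scalar multiples of one map
  \<open>smat u q\<close>. A nonzero entry shows that the two normal forms are proportional, hence
  equal; then entries and linear parts can be compared.\<close>

lemma aut_param_inject:
  assumes g: "g \<in> gl2" "g' \<in> gl2" and p: "(u, q) \<in> smat_params r s" "(u', q') \<in> smat_params r s"
    and eq: "aut_param g (smat u q) L1 L2 = aut_param g' (smat u' q') L1' L2'"
  shows "g = g' \<and> u = u' \<and> q = q' \<and> L1 = L1' \<and> L2 = L2'"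
proof -
  obtain a b c d a' b' c' d' where gs: "g = (a, b, c, d)" "g' = (a', b', c', d')"
    by (metis prod_cases4)
  define S S' where "S = smat u q" and "S' = smat u' q'"
  note inj = smat_params_similitude(2)[OF p(1), folded S_def] smat_params_similitude(2)[OF p(2), folded S'_def]
  have val: "aut_param (a, b, c, d) S L1 L2 x = aut_param (a', b', c', d') S' L1' L2' x" for x
    using eq unfolding gs S_def S'_def by simp
  have a: "scal a (lin S x) = scal a' (lin S' x)" and c: "scal c (lin S x) = scal c' (lin S' x)"
    and b: "scal b (lin S x) = scal b' (lin S' x)" and d: "scal d (lin S x) = scal d' (lin S' x)" for x
    using val[of "(x, 0, 0)"] val[of "(0, x, 0)"] by (simp_all add: lin_scal)
  have e0: "lin S' (1, 0, 0) \<noteq> 0"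
  proof
    assume "lin S' (1, 0, 0) = 0"
    then have "lin S' (1, 0, 0) = lin S' 0"
      by (simp only: lin_0)
    then have "(1, 0, 0) = (0 :: 'a vec3)"
      by (rule injD[OF inj(2)])
    then show False
      by (simp add: zero_prod_def)
  qed
  have params: "u = u' \<and> q = q'" if "k \<noteq> 0" "\<And>x. scal k (lin S x) = scal k' (lin S' x)" for k k'
  proof -
    have eq: "lin S x = scal (k' / k) (lin S' x)" for x
    proof -
      have "scal (1 / k) (scal k (lin S x)) = scal (1 / k) (scal k' (lin S' x))"
        using that(2) by simp
      then show ?thesis
        using that(1) by (simp add: scal_scal)
    qed
    have "k' / k \<noteq> 0"
    proof
      assume "k' / k = 0"
      then have "lin S (1, 0, 0) = lin S 0"
        by (simp only: eq \<open>k' / k = 0\<close> scal_0 lin_0)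
      then have "(1, 0, 0) = (0 :: 'a vec3)"
        by (rule injD[OF inj(1)])
      then show False
        by (simp add: zero_prod_def)
    qed
    then show ?thesis
      using smat_scal_eqD[OF two s_nonzero disc p] eq unfolding S_def S'_def by blast
  qed
  have "a \<noteq> 0 \<or> b \<noteq> 0"
    using g(1) by (auto simp: gl2_def gs)
  then have uq: "u = u' \<and> q = q'"
    using params a b by metis
  then have SS: "S = S'"
    by (simp add: S_def S'_def)
  have cancel: "k = k'" if "\<And>x. scal k (lin S x) = scal k' (lin S' x)" for k k'
  proof -
    have "scal (k - k') (lin S' (1, 0, 0)) = 0"
      using that[of "(1, 0, 0)"] by (simp add: scal_diff_left SS del: lin_simps)
    then show ?thesis
      using e0 by (simp add: scal_eq_0_iff del: lin_simps)
  qed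
  have gg: "a = a'" "b = b'" "c = c'" "d = d'"
    using cancel a b c d by blast+
  have "lin L1 x = lin L1' x" "lin L2 x = lin L2' x" for x
    using val[of "(x, 0, 0)"] val[of "(0, x, 0)"] by (simp_all add: gg SS)
  then have "L1 = L1'" "L2 = L2'"
    by (blast intro: lin_eqD)+
  then show ?thesis
    using uq gg gs by simp
qed

theorem card_autos:
  "card (autos r s) = card (gl2 :: ('a \<times> 'a \<times> 'a \<times> 'a) set) * card (twists r) * Suc (card (tpairs r s)) * card (UNIV :: 'a set) ^ 18"
proof -
  define I where "I = (gl2 :: ('a \<times> 'a \<times> 'a \<times> 'a) set) \<times> smat_params r s \<times> (UNIV :: 'a mat3 set) \<times> (UNIV :: 'a mat3 set)"
  define F where "F = (\<lambda>(g, (u, q), L1, L2). aut_param g (smat u q) L1 L2)"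
  have "inj_on F I"
  proof (rule inj_onI)
    fix x y
    assume xy: "x \<in> I" "y \<in> I" "F x = F y"
    obtain g u q L1 L2 g' u' q' L1' L2' where eqs: "x = (g, (u, q), L1, L2)" "y = (g', (u', q'), L1', L2')"
      by (metis surj_pair)
    have "g = g' \<and> u = u' \<and> q = q' \<and> L1 = L1' \<and> L2 = L2'"
      using xy unfolding eqs by (intro aut_param_inject) (simp_all add: I_def F_def)
    then show "x = y"
      by (simp add: eqs)
  qed
  moreover have "F ` I = autos r s"
  proof
    show "F ` I \<subseteq> autos r s"
    proof
      fix f
      assume "f \<in> F ` I"
      then obtain g u q L1 L2 where "g \<in> gl2" "(u, q) \<in> smat_params r s" "f = aut_param g (smat u q) L1 L2"
        by (auto simp: F_def I_def)
      then show "f \<in> autos r s"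
        using aut_param_autos smat_params_similitude by blast
    qed
    show "autos r s \<subseteq> F ` I"
    proof
      fix f
      assume "f \<in> autos r s"
      then obtain g u q L1 L2 where "g \<in> gl2" "(u, q) \<in> smat_params r s" "f = aut_param g (smat u q) L1 L2"
        using autos_eq_aut_param by blast
      then show "f \<in> F ` I"
        by (intro image_eqI[of _ _ "(g, (u, q), L1, L2)"]) (simp_all add: F_def I_def)
    qed
  qed
  ultimately have "card (autos r s) = card I"
    using card_image by fastforce
  \<comment> \<open>The exponents count the nine entries of \<open>L1\<close> and the nine of
    \<open>L2\<close>.\<close>
  also have "card I = card (gl2 :: ('a \<times> 'a \<times> 'a \<times> 'a) set) * (card (smat_params r s) * (card (UNIV :: 'a set) ^ 9 * card (UNIV :: 'a set) ^ 9))"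
    by (simp add: I_def card_cartesian_product card_UNIV_prod eval_nat_numeral mult.assoc)
  also have "card (smat_params r s) = card (twists r) * Suc (card (tpairs r s))"
  proof -
    have "card (insert None (Some ` tpairs r s)) = Suc (card (tpairs r s))"
      by (subst card_insert_disjoint) (auto simp: card_image)
    then show ?thesis
      by (simp add: smat_params_def card_cartesian_product)
  qed
  finally show ?thesis
    by (simp add: algebra_simps flip: power_add)
qed

end

section \<open>Twists and flexes\<close>

text \<open>The affine points of order 3 on \<open>Y\<^sup>2 = X\<^sup>3 - X\<close>: the tangent has slope
  \<open>(3X\<^sup>2 - 1) / (2Y)\<close>, and its square must be \<open>3X\<close>.\<close>

definition flexes :: "('a::comm_ring_1 \<times> 'a) set" where
  "flexes = {(X, Y). Y\<^sup>2 = X ^ 3 - X \<and> Y \<noteq> 0 \<and> (3 * X\<^sup>2 - 1)\<^sup>2 = 12 * X * Y\<^sup>2}"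

text \<open>With \<open>y = k m^2\<close>, the first two equations give
  \<open>y^2 = (2 x + 6 e) (x^2 - (4 - 3 e^2))\<close>, and \<open>x = 2 X - e\<close>,
  \<open>y = 4 Y\<close> turn this into \<open>Y^2 = X^3 - X\<close> because \<open>e^3 = e\<close>.
  The last two say that \<open>2 k + m\<close> is twice the slope of the tangent and has square
  \<open>12 X\<close>.\<close>

lemma tpairs_equations:
  fixes e :: "'a::field"
  assumes e: "e ^ 3 = e" and km: "(k, m) \<in> tpairs (- 6 * e) (4 - 3 * e\<^sup>2)"
    and x: "x = k\<^sup>2 + k * m"
  shows "m\<^sup>2 = 2 * x + 6 * e" "k\<^sup>2 * m\<^sup>2 = x\<^sup>2 - (4 - 3 * e\<^sup>2)" "3 * (x + e)\<^sup>2 - 4 = k * m\<^sup>2 * (2 * k + m)"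
    "(2 * k + m)\<^sup>2 = 6 * (x + e)"
proof -
  have s: "k ^ 3 * (k + 2 * m) = 4 - 3 * e\<^sup>2" and r: "m\<^sup>2 - 2 * k * m - 2 * k\<^sup>2 - 6 * e = 0"
    using km by (auto simp: tpairs_def)
  show m2: "m\<^sup>2 = 2 * x + 6 * e"
    using r x by algebra
  show "k\<^sup>2 * m\<^sup>2 = x\<^sup>2 - (4 - 3 * e\<^sup>2)"
    using s x by algebra
  show "3 * (x + e)\<^sup>2 - 4 = k * m\<^sup>2 * (2 * k + m)"
    using s r x by algebra
  show "(2 * k + m)\<^sup>2 = 6 * (x + e)"
    using r x by algebra
qed

lemma bij_betw_tpairs_flexes:
  fixes e :: "'a::field"
  assumes two: "(2::'a) \<noteq> 0" and e: "e ^ 3 = e" and s: "4 - 3 * e\<^sup>2 \<noteq> 0"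
    and disc: "(- 6 * e)\<^sup>2 \<noteq> 4 * (4 - 3 * e\<^sup>2)"
  shows "bij_betw (\<lambda>(k, m). ((k\<^sup>2 + k * m + e) / 2, k * m\<^sup>2 / 4)) (tpairs (- 6 * e) (4 - 3 * e\<^sup>2)) flexes"
    (is "bij_betw ?f ?T _")
  unfolding bij_betw_def
proof
  note nonzero = tpairs_nonzero[OF two s disc]
  note four = four_nonzero[OF two]
  show "inj_on ?f ?T"
  proof (rule inj_onI)
    fix z z'
    assume zs: "z \<in> ?T" "z' \<in> ?T" "?f z = ?f z'"
    obtain k m k' m' where z: "z = (k, m)" "z' = (k', m')"
      by (metis surj_pair)
    define x where "x = k\<^sup>2 + k * m"
    have "(x + e) / 2 = (k'\<^sup>2 + k' * m' + e) / 2" "k * m\<^sup>2 / 4 = k' * m'\<^sup>2 / 4"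
      using zs(3) unfolding z x_def case_prod_conv prod.inject by blast+
    then have x': "x = k'\<^sup>2 + k' * m'" and y: "k * m\<^sup>2 = k' * m'\<^sup>2"
      using two four by (metis add_right_cancel divide_cancel_right)+
    have "m\<^sup>2 = m'\<^sup>2"
      using tpairs_equations(1)[OF e zs(1)[unfolded z] x_def] tpairs_equations(1)[OF e zs(2)[unfolded z] x']
      by simp
    moreover have "m\<^sup>2 \<noteq> 0" "k \<noteq> 0"
      using nonzero[OF zs(1)[unfolded z]] by auto
    ultimately have k: "k = k'"
      using y by (metis mult_right_cancel)
    then have "k * m = k * m'"
      using x' x_def by simp
    then show "z = z'"
      using \<open>k \<noteq> 0\<close> k z by simp
  qed
  show "?f ` ?T = flexes"
  proof
    show "?f ` ?T \<subseteq> flexes"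
    proof
      fix P
      assume "P \<in> ?f ` ?T"
      then obtain k m where km: "(k, m) \<in> ?T" and P: "P = ((k\<^sup>2 + k * m + e) / 2, k * m\<^sup>2 / 4)"
        by auto
      define x y X Y where "x = k\<^sup>2 + k * m" and "y = k * m\<^sup>2" and "X = (x + e) / 2" and "Y = y / 4"
      note eqs = tpairs_equations[OF e km x_def]
      have xy: "x = 2 * X - e" "y = 4 * Y"
        using two four by (simp_all add: X_def Y_def field_simps)
      have y0: "y \<noteq> 0"
        using nonzero[OF km] by (simp add: y_def)
      have "y\<^sup>2 = (2 * x + 6 * e) * (x\<^sup>2 - (4 - 3 * e\<^sup>2))"
        using eqs(1,2) y_def by algebra
      then have "4 * 4 * Y\<^sup>2 = 4 * 4 * (X ^ 3 - X)"
        using e unfolding xy by algebra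
      then have curve: "Y\<^sup>2 = X ^ 3 - X"
        using four by (metis mult_left_cancel mult_eq_0_iff)
      have "(3 * (x + e)\<^sup>2 - 4)\<^sup>2 = 6 * (x + e) * y\<^sup>2"
        using eqs(3,4) y_def by algebra
      then have "4 * 4 * (3 * X\<^sup>2 - 1)\<^sup>2 = 4 * 4 * (12 * X * Y\<^sup>2)"
        unfolding xy by algebra
      then have "(3 * X\<^sup>2 - 1)\<^sup>2 = 12 * X * Y\<^sup>2"
        using four by (metis mult_left_cancel mult_eq_0_iff)
      moreover have "Y \<noteq> 0"
        using y0 xy by auto
      ultimately show "P \<in> flexes"
        using curve by (simp add: flexes_def P X_def Y_def x_def y_def)
    qed
    show "flexes \<subseteq> ?f ` ?T"
    proof
      fix P :: "'a \<times> 'a"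
      assume P_flex: "P \<in> flexes"
      obtain X Y where P: "P = (X, Y)"
        by (cases P)
      have curve: "Y\<^sup>2 = X ^ 3 - X" and Y0: "Y \<noteq> 0" and flex: "(3 * X\<^sup>2 - 1)\<^sup>2 = 12 * X * Y\<^sup>2"
        using P_flex by (auto simp: flexes_def P)
      \<comment> \<open>\<open>x\<close> and \<open>y\<close> undo the affine change of coordinates,
        and \<open>z\<close> is to become \<open>m^2\<close>.\<close>
      define x y z where "x = 2 * X - e" and "y = 4 * Y" and "z = 2 * x + 6 * e"
      have y0: "y \<noteq> 0"
        using Y0 four by (simp add: y_def)
      have yz: "y\<^sup>2 = z * (x\<^sup>2 - (4 - 3 * e\<^sup>2))"
        using curve e x_def y_def z_def by algebra
      then have z0: "z \<noteq> 0"
        using y0 by auto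
      \<comment> \<open>Forced by \<open>y = k m^2\<close> and \<open>z = m^2\<close>.\<close>
      define k where "k = y / z"
      have y: "y = k * z"
        using z0 by (simp add: k_def)
      \<comment> \<open>Twice the slope of the tangent at \<open>P\<close>, which is to become
        \<open>2 k + m\<close>; it supplies the sign of \<open>m\<close> that \<open>z\<close>
        leaves open.\<close>
      define c where "c = (3 * (x + e)\<^sup>2 - 4) / y"
      have cy: "c * y = 3 * (x + e)\<^sup>2 - 4"
        using y0 by (simp add: c_def)
      have "y\<^sup>2 * (c\<^sup>2 - 6 * (x + e)) = 0"
        using cy flex x_def y_def by algebra
      then have cc: "c\<^sup>2 = 6 * (x + e)"
        using y0 by simp
      have "z * (k\<^sup>2 * z - (x\<^sup>2 - (4 - 3 * e\<^sup>2))) = 0"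
        using yz y by algebra
      then have kk: "k\<^sup>2 * z = x\<^sup>2 - (4 - 3 * e\<^sup>2)"
        using z0 by simp
      have "z * (k\<^sup>2 - k * c + x) = 0"
        using kk cy y z_def by algebra
      then have kc: "k\<^sup>2 - k * c + x = 0"
        using z0 by simp
      define m where "m = c - 2 * k"
      have x: "x = k\<^sup>2 + k * m"
        using kc m_def by algebra
      have mz: "m\<^sup>2 = z"
        using cc kc m_def z_def by algebra
      have "k ^ 3 * (k + 2 * m) = 4 - 3 * e\<^sup>2"
        using kk mz x by algebra
      moreover have "m\<^sup>2 - 2 * k * m - 2 * k\<^sup>2 - 6 * e = 0"
        unfolding mz unfolding z_def x by (simp add: algebra_simps)
      ultimately have "(k, m) \<in> ?T"
        by (simp add: tpairs_def)
      moreover have "P = ?f (k, m)"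
      proof -
        have "k\<^sup>2 + k * m + e = 2 * X"
          using x x_def by (metis diff_add_cancel)
        moreover have "k * m\<^sup>2 = 4 * Y"
          using y y_def mz by simp
        ultimately show ?thesis
          using two four by (simp add: P)
      qed
      ultimately show "P \<in> ?f ` ?T"
        by (rule rev_image_eqI)
    qed
  qed
qed

section \<open>Square and fourth roots of unity in a finite field\<close>

lemma minus_one_neq_one: "(2::'a::ring_1) \<noteq> 0 \<Longrightarrow> (-1 :: 'a) \<noteq> 1"
  by (metis add.right_inverse one_add_one)

lemma power2_eq_1_set: "{u::'a::field. u\<^sup>2 = 1} = {1, -1}"
  by (auto simp: power2_eq_1_iff)

lemma finite_field_power_card_minus_1:
  fixes x :: "'a::finite_field"
  assumes "x \<noteq> 0"
  shows "x ^ (card (UNIV :: 'a set) - 1) = 1"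
proof -
  have "card (UNIV :: 'a set) = Suc (card (UNIV :: 'a set) - 1)"
    using finite_UNIV_card_ge_0[where ?'a = 'a] by simp
  then have "x * x ^ (card (UNIV :: 'a set) - 1) = x"
    by (metis finite_field_power_card_eq_same power_Suc)
  then show ?thesis
    using assms by simp
qed

text \<open>The polynomial \<open>x^(2 k) - 1\<close> has at most \<open>2 k\<close> roots among the
  \<open>4 k\<close> units. For a unit \<open>x\<close> that is not a root, Fermat leaves only
  \<open>x^(2 k) = -1\<close>, and \<open>x^k\<close> is the square root sought.\<close>

lemma ex_sqrt_minus_1:
  assumes two: "(2::'a::finite_field) \<noteq> 0" and four: "4 dvd card (UNIV :: 'a set) - 1"
  shows "\<exists>v::'a. v\<^sup>2 = -1"
proof -
  obtain k where k: "card (UNIV :: 'a set) - 1 = 4 * k"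
    using four by blast
  have card_nz: "card (UNIV - {0::'a}) = 4 * k"
    using k by (simp add: card_Diff_singleton)
  have "(1::'a) \<in> UNIV - {0}"
    by simp
  then have k0: "k > 0"
    using card_nz by (metis card_gt_0_iff empty_iff finite_Diff finite_UNIV mult_0_right not_gr_zero)
  define P :: "'a poly" where "P = monom 1 (2 * k) - 1"
  have coeff: "coeff P (2 * k) = 1"
    using k0 by (simp add: P_def)
  then have "P \<noteq> 0"
    by auto
  moreover have "degree P \<le> 2 * k"
    unfolding P_def by (intro degree_diff_le) (simp_all add: degree_monom_le)
  ultimately have "card {x. poly P x = 0} \<le> 2 * k"
    using card_poly_roots_bound[of P] by simp
  then have "\<not> UNIV - {0::'a} \<subseteq> {x. poly P x = 0}"
    using card_nz k0 card_mono[of "{x. poly P x = 0}" "UNIV - {0}"] by auto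
  then obtain x :: 'a where x: "x \<noteq> 0" "x ^ (2 * k) \<noteq> 1"
    by (auto simp: P_def poly_monom)
  have "(x ^ (2 * k))\<^sup>2 = 1"
    using finite_field_power_card_minus_1[OF x(1)] k by (simp flip: power_mult)
  then have "x ^ (2 * k) = -1"
    using x(2) by (simp add: power2_eq_1_iff)
  then have "(x ^ k)\<^sup>2 = -1"
    by (simp add: mult.commute flip: power_mult)
  then show ?thesis
    by blast
qed

lemma card_fourth_roots:
  assumes two: "(2::'a::finite_field) \<noteq> 0" and odd: "odd (card (UNIV :: 'a set))"
  shows "card {u::'a. u ^ 4 = 1} = gcd (card (UNIV :: 'a set) - 1) 4"
proof -
  have roots: "{u::'a. u ^ 4 = 1} = {1, -1} \<union> {u. u\<^sup>2 = -1}"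
  proof -
    have "u ^ 4 = 1 \<longleftrightarrow> u\<^sup>2 = 1 \<or> u\<^sup>2 = -1" for u :: 'a
      using power2_eq_1_iff[of "u\<^sup>2"] by (simp flip: power_mult)
    then show ?thesis
      by (auto simp: power2_eq_1_iff)
  qed
  note neq = minus_one_neq_one[OF two]
  show ?thesis
  proof (cases "4 dvd card (UNIV :: 'a set) - 1")
    case True
    obtain v :: 'a where v: "v\<^sup>2 = -1"
      using ex_sqrt_minus_1[OF two True] by blast
    have "{u. u\<^sup>2 = -1} = {v, -v}"
      unfolding v[symmetric] by (auto simp: power2_eq_iff)
    then have four_roots: "{u::'a. u ^ 4 = 1} = {1, -1, v, -v}"
      unfolding roots by auto
    have v1: "v \<noteq> 1" "v \<noteq> -1"
      using v neq by auto
    then have v2: "-v \<noteq> 1" "-v \<noteq> -1"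
      by (metis minus_minus)+
    have v3: "v \<noteq> -v"
    proof
      assume "v = -v"
      then have "2 * v = 0"
        by (simp only: eq_neg_iff_add_eq_0 mult_2)
      then show False
        using two v by auto
    qed
    have "card {u::'a. u ^ 4 = 1} = 4"
    proof -
      have "v \<notin> {-v}" "-1 \<notin> {v, -v}" "1 \<notin> {-1, v, -v}"
        using neq v1 v2 v3 by (metis insertE emptyE)+
      then show ?thesis
        unfolding four_roots by (simp only: card_insert_disjoint finite.intros card.empty simp_thms) simp
    qed
    moreover have "gcd (card (UNIV :: 'a set) - 1) 4 = 4"
      using True by (rule gcd_proj2_if_dvd_nat)
    ultimately show ?thesis
      by (rule trans[OF _ sym])
  next
    case False
    have "even (card (UNIV :: 'a set) - 1)"
      using odd by simp
    then obtain k where k: "card (UNIV :: 'a set) - 1 = 2 * k"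
      by (rule dvdE)
    have "odd k"
    proof
      assume "even k"
      then obtain j where "k = 2 * j"
        by (rule dvdE)
      then have "card (UNIV :: 'a set) - 1 = 4 * j"
        using k by simp
      then show False
        using False by simp
    qed
    \<comment> \<open>By Fermat \<open>(u^2)^k = 1\<close>, whereas \<open>(-1)^k = -1\<close> for
      odd \<open>k\<close>.\<close>
    have "{u::'a. u\<^sup>2 = -1} = {}"
    proof -
      have False if "u\<^sup>2 = -1" for u :: 'a
      proof -
        have "u \<noteq> 0"
          using that by auto
        then have "(u\<^sup>2) ^ k = 1"
          using finite_field_power_card_minus_1[of u] k by (simp flip: power_mult)
        then show False
          using \<open>odd k\<close> that neq by simp
      qed
      then show ?thesis
        by blast
    qed
    then have "card {u::'a. u ^ 4 = 1} = 2"
      unfolding roots using neq by simp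
    moreover have "gcd (card (UNIV :: 'a set) - 1) 4 = 2"
    proof -
      have "gcd (2 * k) (2 * 2) = 2 * gcd k 2"
        by (rule gcd_mult_distrib_nat[symmetric])
      also have "gcd k 2 = 1"
        using \<open>odd k\<close> by (simp add: coprime_right_2_iff_odd flip: coprime_iff_gcd_eq_1)
      finally show ?thesis
        unfolding k by simp
    qed
    ultimately show ?thesis
      by (rule trans[OF _ sym])
  qed
qed

lemma card_square_roots_1:
  assumes two: "(2::'a::field) \<noteq> 0"
  shows "card {u::'a. u\<^sup>2 = 1} = 2"
  using minus_one_neq_one[OF two] by (auto simp: power2_eq_1_set)

section \<open>Transfer from residues to a field of prime order\<close>

text \<open>Translation by 1 permutes the ring, so adding 1 to every element leaves the sum of all
  elements unchanged.\<close>

lemma of_nat_card_UNIV: "of_nat (card (UNIV :: 'a set)) = (0 :: 'a::{ring_1,finite})"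
proof -
  have "(\<Sum>x\<in>UNIV. x + 1) = (\<Sum>x\<in>UNIV. x :: 'a)"
    by (rule sum.reindex_bij_witness[of _ "\<lambda>x. x - 1" "\<lambda>x. x + 1"]) auto
  then show ?thesis
    unfolding sum.distrib by simp
qed

lemma CHAR_eq_card:
  assumes "prime (card (UNIV :: 'a::finite_field set))"
  shows "CHAR('a) = card (UNIV :: 'a set)"
proof (rule primes_dvd_imp_eq)
  show "CHAR('a) dvd card (UNIV :: 'a set)"
    unfolding of_nat_eq_0_iff_char_dvd[symmetric] by (rule of_nat_card_UNIV)
qed (use assms in simp_all)

text \<open>The definitions compute with integers in \<open>{0..<p}\<close>, while the algebra above
  needs a field type. Any type with \<open>p\<close> elements will do, and \<open>of_int\<close>
  leads from the residues to it.\<close>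

locale prime_order_field =
  fixes p :: nat and ty :: "'a::finite_field itself"
  assumes card_eq: "card (UNIV :: 'a set) = p" and prime_p: "prime p" and odd_p: "odd p"
begin

lemma CHAR_eq: "CHAR('a) = p"
  using CHAR_eq_card[where 'a = 'a] card_eq prime_p by simp

lemma of_int_eq_iff: "(of_int x :: 'a) = of_int y \<longleftrightarrow> [x = y] (mod int p)"
  using of_int_eq_iff_cong_CHAR[where 'a = 'a] by (simp add: CHAR_eq)

lemma of_int_mod [simp]: "(of_int (x mod int p) :: 'a) = of_int x"
  by (simp add: of_int_eq_iff cong_def)

lemma of_int_eq_0_iff: "(of_int x :: 'a) = 0 \<longleftrightarrow> x mod int p = 0"
  using of_int_eq_iff[of x 0] by (simp add: cong_def)

lemma bij_of_int: "bij_betw (of_int :: int \<Rightarrow> 'a) {0..<int p} UNIV"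
proof -
  have inj: "inj_on (of_int :: int \<Rightarrow> 'a) {0..<int p}"
    by (rule inj_onI) (simp add: of_int_eq_iff cong_def)
  then have "card ((of_int :: int \<Rightarrow> 'a) ` {0..<int p}) = card (UNIV :: 'a set)"
    by (simp add: card_image card_eq)
  then have "(of_int :: int \<Rightarrow> 'a) ` {0..<int p} = UNIV"
    by (metis card_subset_eq finite_class.finite_UNIV subset_UNIV)
  with inj show ?thesis
    by (simp add: bij_betw_def)
qed

lemma of_int_inj: "x \<in> {0..<int p} \<Longrightarrow> y \<in> {0..<int p} \<Longrightarrow> (of_int x :: 'a) = of_int y \<longleftrightarrow> x = y"
  using bij_of_int unfolding bij_betw_def by (metis inj_on_eq_iff)

lemma of_int_surj: obtains n where "n \<in> {0..<int p}" "x = (of_int n :: 'a)"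
proof -
  have "x \<in> of_int ` {0..<int p}"
    using bij_of_int by (simp add: bij_betw_def)
  then show thesis
    using that by blast
qed

lemma prime_field: "\<exists>n. x = (of_nat n :: 'a)"
proof -
  obtain n where "n \<in> {0..<int p}" "x = (of_int n :: 'a)"
    by (rule of_int_surj[of x])
  then have "x = of_nat (nat n)"
    by simp
  then show ?thesis ..
qed

lemma two: "(2 :: 'a) \<noteq> 0"
proof
  assume "(2 :: 'a) = 0"
  then have "of_nat 2 = (0 :: 'a)"
    by simp
  then have "p dvd 2"
    by (simp only: of_nat_eq_0_iff_char_dvd CHAR_eq)
  then show False
    using primes_dvd_imp_eq[OF prime_p two_is_prime_nat] odd_p by simp
qed

section \<open>Invertible matrices and 3-torsion points over the residues\<close>

lemma card_GL2: "card (GL2 (int p)) = card (gl2 :: ('a \<times> 'a \<times> 'a \<times> 'a) set)"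
proof (rule bij_betw_same_card)
  show "bij_betw (\<lambda>(a, b, c, d). (of_int a, of_int b, of_int c, of_int d)) (GL2 (int p)) (gl2 :: ('a \<times> 'a \<times> 'a \<times> 'a) set)"
    (is "bij_betw ?f _ _")
    unfolding bij_betw_def
  proof
    have det: "(of_int a * of_int d - of_int b * of_int c :: 'a) = 0 \<longleftrightarrow> (a * d - b * c) mod int p = 0" for a b c d
      using of_int_eq_0_iff[of "a * d - b * c"] by simp
    show "inj_on ?f (GL2 (int p))"
      by (rule inj_onI) (auto simp: GL2_def of_int_inj)
    show "?f ` GL2 (int p) = gl2"
    proof
      show "?f ` GL2 (int p) \<subseteq> gl2"
        by (auto simp: GL2_def gl2_def simp flip: det)
      show "gl2 \<subseteq> ?f ` GL2 (int p)"
      proof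
        fix z :: "'a \<times> 'a \<times> 'a \<times> 'a"
        assume z: "z \<in> gl2"
        obtain a b c d where abcd: "a \<in> {0..<int p}" "b \<in> {0..<int p}" "c \<in> {0..<int p}" "d \<in> {0..<int p}"
          and z_eq: "z = (of_int a, of_int b, of_int c, of_int d)"
          using of_int_surj by (metis prod_cases4)
        have "(a, b, c, d) \<in> GL2 (int p)"
          using z abcd det by (simp add: z_eq GL2_def gl2_def)
        then show "z \<in> ?f ` GL2 (int p)"
          by (rule rev_image_eqI) (simp add: z_eq)
      qed
    qed
  qed
qed

lemma of_int_fp_inv: "(of_int (fp_inv (int p) x) :: 'a) = inverse (of_int x)"
proof (cases "(of_int x :: 'a) = 0")
  case True
  \<comment> \<open>With \<open>p = 2\<close> the exponent would be 0 and \<open>0 ^ 0 = 1\<close>;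
    for odd \<open>p\<close> the power of 0 is 0, in accordance with
    \<open>inverse 0 = 0\<close>.\<close>
  have "nat (int p - 2) \<noteq> 0"
    using prime_p odd_p prime_ge_2_nat[of p] by (cases "p = 2") auto
  then show ?thesis
    by (simp add: fp_inv_def True)
next
  case False
  have "p \<ge> 3"
    using prime_p odd_p prime_ge_2_nat[of p] by (cases "p = 2") auto
  then have "Suc (nat (int p - 2)) = p - 1"
    by simp
  then have "(of_int x :: 'a) * of_int x ^ nat (int p - 2) = 1"
    using finite_field_power_card_minus_1[OF False] by (metis card_eq power_Suc)
  then show ?thesis
    by (simp add: fp_inv_def inverse_unique)
qed

text \<open>\<open>3 P = O\<close> means \<open>2 P = - P\<close>. If \<open>Y = 0\<close>, then
  \<open>2 P = O\<close> and \<open>3 P = P\<close>, which is not \<open>O\<close>. Otherwise it is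
  enough to compare abscissas, since \<open>x3 = x\<close> makes the tangent formula return
  \<open>y3 = - y\<close>; and \<open>l^2 - 2 X = X\<close> says \<open>l^2 = 3 X\<close>.\<close>

lemma Some_E1_3tors_iff:
  assumes x: "x \<in> {0..<int p}" and y: "y \<in> {0..<int p}"
  shows "Some (x, y) \<in> E1_3tors (int p) \<longleftrightarrow> ((of_int x, of_int y) :: 'a \<times> 'a) \<in> flexes"
proof -
  define X Y where "X = (of_int x :: 'a)" and "Y = (of_int y :: 'a)"
  have curve: "on_curve (int p) (-1) 0 (Some (x, y)) \<longleftrightarrow> Y\<^sup>2 = X ^ 3 - X"
    using x y of_int_eq_0_iff[of "y\<^sup>2 - (x ^ 3 - x)"] by (simp add: on_curve_def X_def Y_def)
  have Y0: "(y + y) mod int p = 0 \<longleftrightarrow> Y = 0"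
    using of_int_eq_0_iff[of "y + y"] two by (simp add: Y_def flip: mult_2)
  show ?thesis
  proof (cases "Y = 0")
    case True
    then have "ec_add (int p) (-1) (Some (x, y)) (Some (x, y)) = None"
      using Y0 by (simp add: ec_add_def)
    then have "ec_add (int p) (-1) (Some (x, y)) (ec_add (int p) (-1) (Some (x, y)) (Some (x, y))) = Some (x, y)"
      by (simp add: ec_add_def)
    then show ?thesis
      using True by (simp add: E1_3tors_def flexes_def X_def Y_def)
  next
    case False
    define l where "l = ((3 * x\<^sup>2 + -1) * fp_inv (int p) (2 * y)) mod int p"
    define x3 where "x3 = (l\<^sup>2 - x - x) mod int p"
    define y3 where "y3 = (l * (x - x3) - y) mod int p"
    have double: "ec_add (int p) (-1) (Some (x, y)) (Some (x, y)) = Some (x3, y3)"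
      using Y0 False by (simp add: ec_add_def Let_def l_def x3_def y3_def)
    have ec: "ec_add (int p) (-1) (Some (x, y)) (ec_add (int p) (-1) (Some (x, y)) (Some (x, y))) = None
        \<longleftrightarrow> x = x3 \<and> (y + y3) mod int p = 0"
      unfolding double by (simp add: ec_add_def Let_def)
    have l: "of_int l = (3 * X\<^sup>2 - 1) / (2 * Y)"
      unfolding l_def of_int_mod of_int_mult of_int_fp_inv divide_inverse X_def Y_def by simp
    have x3: "of_int x3 = (of_int l)\<^sup>2 - 2 * X"
      by (simp add: x3_def X_def)
    have y3: "of_int y3 = of_int l * (X - of_int x3) - Y"
      by (simp add: y3_def X_def Y_def)
    have x3_range: "x3 \<in> {0..<int p}"
      using prime_gt_0_nat[OF prime_p] by (simp add: x3_def)
    have x_eq: "x = x3 \<longleftrightarrow> X = of_int x3"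
      unfolding X_def using of_int_inj[OF x x3_range] by blast
    have "(y + y3) mod int p = 0" if "X = of_int x3"
    proof -
      have "of_int (y + y3) = (0 :: 'a)"
        unfolding of_int_add y3 that[symmetric] Y_def[symmetric] by simp
      then show ?thesis
        by (simp only: of_int_eq_0_iff)
    qed
    then have "x = x3 \<and> (y + y3) mod int p = 0 \<longleftrightarrow> X = of_int x3"
      using x_eq by blast
    also have "\<dots> \<longleftrightarrow> 3 * X = ((3 * X\<^sup>2 - 1) / (2 * Y))\<^sup>2"
    proof -
      have "X = c - 2 * X \<longleftrightarrow> 3 * X = c" for c
        unfolding eq_diff_eq by simp
      then show ?thesis
        unfolding x3 l .
    qed
    also have "\<dots> \<longleftrightarrow> (3 * X\<^sup>2 - 1)\<^sup>2 = 12 * X * Y\<^sup>2"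
    proof -
      have "((3 * X\<^sup>2 - 1) / (2 * Y))\<^sup>2 = (3 * X\<^sup>2 - 1)\<^sup>2 / (4 * Y\<^sup>2)"
        by (simp add: power_divide power_mult_distrib)
      moreover have "4 * Y\<^sup>2 \<noteq> 0"
        using False four_nonzero[OF two] by simp
      moreover have "3 * X * (4 * Y\<^sup>2) = 12 * X * Y\<^sup>2"
        by (simp add: mult.left_commute)
      ultimately show ?thesis
        by (metis nonzero_eq_divide_eq)
    qed
    finally show ?thesis
      using ec curve False by (simp add: E1_3tors_def flexes_def X_def Y_def)
  qed
qed

lemma card_E1_3tors: "card (E1_3tors (int p)) = Suc (card (flexes :: ('a \<times> 'a) set))"
proof -
  define A where "A = {(x, y). Some (x, y) \<in> E1_3tors (int p)}"
  have range: "x \<in> {0..<int p} \<and> y \<in> {0..<int p}" if "(x, y) \<in> A" for x y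
    using that by (auto simp: A_def E1_3tors_def on_curve_def)
  have "bij_betw (\<lambda>(x, y). (of_int x, of_int y)) A (flexes :: ('a \<times> 'a) set)" (is "bij_betw ?f _ _")
    unfolding bij_betw_def
  proof
    show "inj_on ?f A"
      by (rule inj_onI) (auto simp: of_int_inj dest!: range)
    show "?f ` A = flexes"
    proof
      show "?f ` A \<subseteq> flexes"
      proof
        fix z
        assume "z \<in> ?f ` A"
        then obtain x y where xy: "(x, y) \<in> A" and z: "z = (of_int x, of_int y)"
          by auto
        have "Some (x, y) \<in> E1_3tors (int p)"
          using xy by (simp add: A_def)
        then show "z \<in> flexes"
          unfolding z using Some_E1_3tors_iff range[OF xy] by blast
      qed
      show "flexes \<subseteq> ?f ` A"
      proof
        fix z :: "'a \<times> 'a"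
        assume z: "z \<in> flexes"
        obtain x y where xy: "x \<in> {0..<int p}" "y \<in> {0..<int p}" and z_eq: "z = (of_int x, of_int y)"
          using of_int_surj by (metis surj_pair)
        have "Some (x, y) \<in> E1_3tors (int p)"
          using z unfolding z_eq Some_E1_3tors_iff[OF xy] .
        then have "(x, y) \<in> A"
          by (simp add: A_def)
        then show "z \<in> ?f ` A"
          by (rule rev_image_eqI) (simp add: z_eq)
      qed
    qed
  qed
  then have card: "card A = card (flexes :: ('a \<times> 'a) set)"
    by (rule bij_betw_same_card)
  have "finite A"
    by (rule finite_subset[of _ "{0..<int p} \<times> {0..<int p}"]) (use range in auto)
  have None: "None \<in> E1_3tors (int p)"
    by (simp add: E1_3tors_def on_curve_def ec_add_def)
  have "E1_3tors (int p) = insert None (Some ` A)"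
  proof -
    have "z \<in> E1_3tors (int p) \<longleftrightarrow> z \<in> insert None (Some ` A)" for z
    proof (cases z)
      case (Some xy)
      then show ?thesis
        by (cases xy) (auto simp: A_def)
    qed (simp add: None)
    then show ?thesis
      by (rule Set.set_eqI)
  qed
  moreover have "card (insert None (Some ` A)) = Suc (card (Some ` A))"
    using \<open>finite A\<close> by (intro card_insert_disjoint) auto
  moreover have "card (Some ` A) = card A"
    by (intro card_image) simp
  ultimately show ?thesis
    using card by simp
qed

end

text \<open>Conjugation by \<psi> is the bijection. Members of \<open>auto G\<close> are extensional
  on the carrier, whereas \<open>autos\<close> consists of functions on a whole type; therefore the
  way back has to restrict.\<close>

lemma card_auto_eq_card_autos:
  fixes \<psi> :: "'b \<Rightarrow> 'a::comm_ring_1 heis"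
  assumes bij: "bij_betw \<psi> (carrier G) UNIV"
    and closed: "\<And>x y. x \<in> carrier G \<Longrightarrow> y \<in> carrier G \<Longrightarrow> x \<otimes>\<^bsub>G\<^esub> y \<in> carrier G"
    and hom: "\<And>x y. x \<in> carrier G \<Longrightarrow> y \<in> carrier G \<Longrightarrow> \<psi> (x \<otimes>\<^bsub>G\<^esub> y) = gmul r s (\<psi> x) (\<psi> y)"
  shows "card (auto G) = card (autos r s)"
proof -
  define \<theta> where "\<theta> = inv_into (carrier G) \<psi>"
  have \<theta>_in: "\<theta> a \<in> carrier G" and \<psi>\<theta>: "\<psi> (\<theta> a) = a" for a
    using bij by (auto simp: \<theta>_def bij_betw_def intro: inv_into_into f_inv_into_f)
  have \<theta>\<psi>: "\<theta> (\<psi> x) = x" if "x \<in> carrier G" for x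
    using bij that by (simp add: \<theta>_def bij_betw_def)
  have bij_\<theta>: "bij_betw \<theta> UNIV (carrier G)"
    unfolding \<theta>_def using bij by (rule bij_betw_inv_into)
  have \<theta>_mul: "\<theta> (gmul r s a b) = \<theta> a \<otimes>\<^bsub>G\<^esub> \<theta> b" for a b
  proof -
    have "gmul r s a b = \<psi> (\<theta> a \<otimes>\<^bsub>G\<^esub> \<theta> b)"
      using hom[OF \<theta>_in \<theta>_in] by (simp add: \<psi>\<theta>)
    then show ?thesis
      using \<theta>\<psi>[OF closed[OF \<theta>_in \<theta>_in]] by simp
  qed
  have "bij_betw (\<lambda>g. \<psi> \<circ> g \<circ> \<theta>) (auto G) (autos r s)"
  proof (rule bij_betw_byWitness[where f' = "\<lambda>f. restrict (\<theta> \<circ> f \<circ> \<psi>) (carrier G)"])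
    show "\<forall>g\<in>auto G. restrict (\<theta> \<circ> (\<psi> \<circ> g \<circ> \<theta>) \<circ> \<psi>) (carrier G) = g"
    proof
      fix g
      assume g: "g \<in> auto G"
      then have ext: "g \<in> extensional (carrier G)" and "bij_betw g (carrier G) (carrier G)"
        by (auto simp: auto_def Bij_def)
      then have "g x \<in> carrier G" if "x \<in> carrier G" for x
        using that by (metis bij_betwE)
      then show "restrict (\<theta> \<circ> (\<psi> \<circ> g \<circ> \<theta>) \<circ> \<psi>) (carrier G) = g"
        by (intro extensionalityI[OF _ ext]) (simp_all add: \<theta>\<psi>)
    qed
    show "\<forall>f\<in>autos r s. \<psi> \<circ> restrict (\<theta> \<circ> f \<circ> \<psi>) (carrier G) \<circ> \<theta> = f"
      by (simp add: fun_eq_iff \<theta>_in \<psi>\<theta> del: split_paired_All)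
    show "(\<lambda>g. \<psi> \<circ> g \<circ> \<theta>) ` auto G \<subseteq> autos r s"
    proof
      fix f
      assume "f \<in> (\<lambda>g. \<psi> \<circ> g \<circ> \<theta>) ` auto G"
      then obtain g where g: "g \<in> auto G" and f: "f = \<psi> \<circ> g \<circ> \<theta>"
        by blast
      have bij_g: "bij_betw g (carrier G) (carrier G)"
        using g by (auto simp: auto_def Bij_def)
      have g_mul: "g (x \<otimes>\<^bsub>G\<^esub> y) = g x \<otimes>\<^bsub>G\<^esub> g y" if "x \<in> carrier G" "y \<in> carrier G" for x y
        using g that by (simp add: auto_def hom_def)
      have "bij f"
        unfolding f using bij_\<theta> bij_g bij by (metis bij_betw_trans)
      moreover have "f (gmul r s a b) = gmul r s (f a) (f b)" for a b
        using hom bij_betwE[OF bij_g] by (simp add: f \<theta>_mul g_mul \<theta>_in)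
      ultimately show "f \<in> autos r s"
        by (simp add: autos_def del: split_paired_All)
    qed
    show "(\<lambda>f. restrict (\<theta> \<circ> f \<circ> \<psi>) (carrier G)) ` autos r s \<subseteq> auto G"
    proof
      fix g
      assume "g \<in> (\<lambda>f. restrict (\<theta> \<circ> f \<circ> \<psi>) (carrier G)) ` autos r s"
      then obtain f where f: "f \<in> autos r s" and g: "g = restrict (\<theta> \<circ> f \<circ> \<psi>) (carrier G)"
        by blast
      have "bij_betw (\<theta> \<circ> f \<circ> \<psi>) (carrier G) (carrier G)"
        using bij_\<theta> autosD(1)[OF f] bij by (metis bij_betw_trans)
      then have "g \<in> Bij (carrier G)"
        unfolding g Bij_def by (simp add: bij_betw_restrict_eq)
      moreover have "g \<in> hom G G"
        unfolding hom_def g by (simp add: closed \<theta>_in hom autosD(2)[OF f] \<theta>_mul)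
      ultimately show "g \<in> auto G"
        by (simp add: auto_def)
    qed
  qed
  then show ?thesis
    by (rule bij_betw_same_card)
qed

text \<open>The matrices \<open>B\<^sub>1\<^sub>,\<^sub>1\<close>, \<open>B\<^sub>2\<^sub>,\<^sub>1\<close>, \<open>B\<^sub>3\<^sub>,\<^sub>1\<close> are the members
  \<open>e = 0, 1, -1\<close> of one family.\<close>

definition Bfam :: "int \<Rightarrow> (nat \<Rightarrow> int) \<Rightarrow> int list list" where
  "Bfam e y = [[3 * e * y 0 + y 2, - y 1, y 0 - e * y 2],
               [- y 1, - y 0 - e * y 2, - e * y 1],
               [y 0 - e * y 2, - e * y 1, - e * y 0 + y 2]]"

lemma Bfam_instances: "Bfam 0 = B11" "Bfam 1 = B21" "Bfam (-1) = B31"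
  by (simp_all add: fun_eq_iff Bfam_def B11_def B21_def B31_def)

section \<open>Coordinates that bring the given groups into the normal form\<close>

context prime_order_field
begin

definition vec_of :: "(nat \<Rightarrow> int) \<Rightarrow> 'a vec3" where
  "vec_of v = (of_int (v 0), of_int (v 1), of_int (v 2))"

lemma less_3_iff: "j < (3::nat) \<longleftrightarrow> j = 0 \<or> j = 1 \<or> j = 2"
  by auto

lemma bij_vec_of: "bij_betw vec_of (vecs (int p)) UNIV"
  unfolding bij_betw_def
proof
  show "inj_on vec_of (vecs (int p))"
  proof (rule inj_onI)
    fix v w
    assume v: "v \<in> vecs (int p)" and w: "w \<in> vecs (int p)" and eq: "vec_of v = vec_of w"
    have "v j = w j" for j
    proof (cases "j < 3")
      case True
      then have "(of_int (v j) :: 'a) = of_int (w j)"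
        using eq by (auto simp: vec_of_def less_3_iff)
      moreover have "v j \<in> {0..<int p}" "w j \<in> {0..<int p}"
        using v w True by (simp_all add: vecs_def)
      ultimately show ?thesis
        using of_int_inj by blast
    next
      case False
      then show ?thesis
        using v w by (simp add: vecs_def)
    qed
    then show "v = w"
      by blast
  qed
  have "x \<in> vec_of ` vecs (int p)" for x
  proof -
    obtain a b c where abc: "a \<in> {0..<int p}" "b \<in> {0..<int p}" "c \<in> {0..<int p}"
      and x: "x = (of_int a, of_int b, of_int c)"
      using of_int_surj by (metis prod_cases3)
    define v where "v = (\<lambda>j::nat. if j = 0 then a else if j = 1 then b else if j = 2 then c else 0)"
    have "v \<in> vecs (int p)"
      using abc by (auto simp: vecs_def v_def)
    moreover have "x = vec_of v"
      by (simp add: x vec_of_def v_def)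
    ultimately show ?thesis
      by blast
  qed
  then show "vec_of ` vecs (int p) = UNIV"
    by blast
qed

lemma vec_of_vadd: "vec_of (vadd (int p) u w) = vec_of u + vec_of w"
  by (simp add: vec_of_def vadd_def)

lemma vadd_vecs: "vadd (int p) u w \<in> vecs (int p)"
  using prime_gt_0_nat[OF prime_p] by (simp add: vecs_def vadd_def)

text \<open>Changes of coordinates taking \<^const>\<open>phi\<close> of \<^term>\<open>Bfam e\<close> to \<^const>\<open>frm\<close>.\<close>

definition uw_change :: "'a \<Rightarrow> 'a vec3 \<Rightarrow> 'a vec3" where
  "uw_change e = (\<lambda>(x1, x2, x3). (x1 + e * x3, x2, 3 * e * x1 + (2 - 3 * e\<^sup>2) * x3))"

definition t_change :: "'a \<Rightarrow> 'a vec3 \<Rightarrow> 'a vec3" where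
  "t_change e = (\<lambda>(t1, t2, t3). (2 * t1, - t2, 4 * t3 + 2 * e * t1))"

text \<open>\<open>2 - 6 e^2\<close> is the determinant of the change of the first and third
  coordinates.\<close>

lemma bij_uw_change:
  assumes "2 - 6 * e\<^sup>2 \<noteq> 0"
  shows "bij (uw_change e)"
proof -
  have "inj (uw_change e)"
  proof (rule injI)
    fix x y
    assume eq: "uw_change e x = uw_change e y"
    obtain x1 x2 x3 y1 y2 y3 where xy: "x = (x1, x2, x3)" "y = (y1, y2, y3)"
      by (metis prod_cases3)
    have "x1 + e * x3 = y1 + e * y3" "3 * e * x1 + (2 - 3 * e\<^sup>2) * x3 = 3 * e * y1 + (2 - 3 * e\<^sup>2) * y3"
      and x2: "x2 = y2"
      using eq by (simp_all add: uw_change_def xy)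
    then have "(2 - 6 * e\<^sup>2) * (x3 - y3) = 0" "(2 - 6 * e\<^sup>2) * (x1 - y1) = 0"
      by algebra+
    then show "x = y"
      using assms x2 by (simp add: xy)
  qed
  then show ?thesis
    by (simp add: bij_def finite_UNIV_inj_surj)
qed

lemma bij_t_change: "bij (t_change e)"
proof -
  have "inj (t_change e)"
    using two four_nonzero[OF two] by (intro injI) (auto simp: t_change_def)
  then show ?thesis
    by (simp add: bij_def finite_UNIV_inj_surj)
qed

lemma uw_change_add: "uw_change e (x + y) = uw_change e x + uw_change e y"
  by (cases x; cases y) (simp add: uw_change_def algebra_simps)

lemma t_change_add: "t_change e (x + y) = t_change e x + t_change e y"
  by (cases x; cases y) (simp add: t_change_def algebra_simps)

lemma t_change_phi:
  assumes e: "e ^ 3 = e"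
  shows "t_change (of_int e) (vec_of (phi (Bfam e) (int p) u w)) =
    frm (- 6 * of_int e) (4 - 3 * (of_int e)\<^sup>2) (uw_change (of_int e) (vec_of u)) (uw_change (of_int e) (vec_of w))"
proof -
  define E u1 u2 u3 w1 w2 w3 where "E = (of_int e :: 'a)"
    and uw: "u1 = (of_int (u 0) :: 'a)" "u2 = (of_int (u 1) :: 'a)" "u3 = (of_int (u 2) :: 'a)"
    "w1 = (of_int (w 0) :: 'a)" "w2 = (of_int (w 1) :: 'a)" "w3 = (of_int (w 2) :: 'a)"
  have "E ^ 3 = E"
    using e unfolding E_def by (metis of_int_power)
  then have "E * ((E - 1) * (E + 1)) = 0"
    by (simp add: algebra_simps power3_eq_cube)
  \<comment> \<open>The identity holds only modulo \<open>e^3 = e\<close>: in the first coordinate,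
    the coefficient of \<open>u3 * w3\<close> is \<open>- 2 e\<close> on one side and
    \<open>4 e - 6 e^3\<close> on the other. Hence the check value by value.\<close>
  then have E: "E = 0 \<or> E = 1 \<or> E = -1"
    by (auto simp: eq_neg_iff_add_eq_0)
  have phi: "vec_of (phi (Bfam e) (int p) u w) =
    (3 * E * u1 * w1 + u1 * w3 + u3 * w1 - u2 * w2 - E * u3 * w3,
     - (u1 * w2 + u2 * w1) - E * (u2 * w3 + u3 * w2),
     u1 * w1 - E * (u1 * w3 + u3 * w1) - E * u2 * w2 + u3 * w3)"
    by (simp add: vec_of_def phi_def Bcoef_def Bfam_def numeral_3_eq_3 lessThan_Suc uw E_def
        numeral_2_eq_2 algebra_simps)
  show ?thesis
    unfolding phi unfolding vec_of_def uw[symmetric] E_def[symmetric] uw_change_def t_change_def case_prod_conv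
      frm_simps prod.inject
    using E by (elim disjE) (simp_all add: algebra_simps)
qed

end

lemma G_B_mult:
  "(u, w, t) \<otimes>\<^bsub>G_B B p\<^esub> (u', w', t') = (vadd p u u', vadd p w w', vadd p (vadd p t t') (phi B p u w'))"
  by (simp add: G_B_def)

context prime_order_field
begin

lemma card_auto_G_B_Bfam:
  assumes e: "e ^ 3 = e" and det: "2 - 6 * (of_int e)\<^sup>2 \<noteq> (0 :: 'a)"
  shows "card (auto (G_B (Bfam e) (int p))) =
    card (autos (- 6 * of_int e) (4 - 3 * (of_int e)\<^sup>2) :: ('a heis \<Rightarrow> 'a heis) set)"
proof (rule card_auto_eq_card_autos)
  let ?R = "uw_change (of_int e) \<circ> vec_of" and ?T = "t_change (of_int e) \<circ> vec_of"
  let ?\<psi> = "map_prod ?R (map_prod ?R ?T)"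
  have carrier: "carrier (G_B (Bfam e) (int p)) = vecs (int p) \<times> vecs (int p) \<times> vecs (int p)"
    by (simp add: G_B_def)
  have R: "bij_betw ?R (vecs (int p)) UNIV" and T: "bij_betw ?T (vecs (int p)) UNIV"
    using bij_vec_of bij_uw_change[OF det] bij_t_change by (blast intro: bij_betw_trans)+
  show "bij_betw ?\<psi> (carrier (G_B (Bfam e) (int p))) UNIV"
    unfolding carrier using bij_betw_map_prod[OF R bij_betw_map_prod[OF R T]] by simp
  fix x y
  assume xy: "x \<in> carrier (G_B (Bfam e) (int p))" "y \<in> carrier (G_B (Bfam e) (int p))"
  obtain u w t u' w' t' where eqs: "x = (u, w, t)" "y = (u', w', t')"
    by (metis prod_cases3)
  show "x \<otimes>\<^bsub>G_B (Bfam e) (int p)\<^esub> y \<in> carrier (G_B (Bfam e) (int p))"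
    unfolding eqs G_B_mult carrier by (simp add: vadd_vecs)
  show "?\<psi> (x \<otimes>\<^bsub>G_B (Bfam e) (int p)\<^esub> y) = gmul (- 6 * of_int e) (4 - 3 * (of_int e)\<^sup>2) (?\<psi> x) (?\<psi> y)"
    unfolding eqs G_B_mult map_prod_simp gmul_simps o_apply vec_of_vadd uw_change_add t_change_add
      t_change_phi[OF e] ..
qed

section \<open>Evaluation of the count for the three members of the family\<close>

lemma three_eq_0D: "(3 :: 'a) = 0 \<Longrightarrow> p = 3"
proof -
  assume "(3 :: 'a) = 0"
  then have "of_nat 3 = (0 :: 'a)"
    by simp
  then have "p dvd 3"
    by (simp only: of_nat_eq_0_iff_char_dvd CHAR_eq)
  then show "p = 3"
    using primes_dvd_imp_eq[OF prime_p] by simp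
qed

text \<open>If \<open>p\<close> is not 3, the factor 6 cancels in \<open>r u^2 = r\<close>. If
  \<open>p = 3\<close>, then \<open>u^3 = u\<close> by Fermat, which turns \<open>u^4 = 1\<close>
  into \<open>u^2 = 1\<close>.\<close>

lemma twists_eq_square_roots:
  fixes r :: 'a
  assumes "r = 6 \<or> r = -6"
  shows "twists r = {u. u\<^sup>2 = 1}"
proof -
  have "u\<^sup>2 = 1" if "u \<in> twists r" for u
  proof -
    have u: "u ^ 4 = 1" "r * (u\<^sup>2 - 1) = 0"
      using that by (simp_all add: twists_def right_diff_distrib)
    show ?thesis
    proof (cases "(3 :: 'a) = 0")
      case True
      have "u ^ 3 = u"
        using finite_field_power_card_eq_same[of u] card_eq three_eq_0D[OF True] by simp
      then have "u ^ 4 = u\<^sup>2"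
        by (simp add: eval_nat_numeral)
      then show ?thesis
        using u by simp
    next
      case False
      have "(6 :: 'a) = 2 * 3"
        by simp
      then have "(6 :: 'a) \<noteq> 0"
        using False two by (metis mult_eq_0_iff)
      then show ?thesis
        using u(2) assms by auto
    qed
  qed
  moreover have "u \<in> twists r" if "u\<^sup>2 = 1" for u
    using that power_mult[of u 2 2] by (simp add: twists_def)
  ultimately show ?thesis
    by blast
qed

lemma card_auto_G_B:
  assumes e: "e = 0 \<or> e = 1 \<or> e = -1"
  shows "card (auto (G_B (Bfam e) (int p))) =
    gcd (p - 1) (if e = 0 then 4 else 2) * card (GL2 (int p)) * p ^ 18 * card (E1_3tors (int p))"
proof -
  define E where "E = (of_int e :: 'a)"
  have E: "E = 0 \<or> E = 1 \<or> E = -1"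
    using e by (auto simp: E_def)
  have e3: "e ^ 3 = e" and E3: "E ^ 3 = E"
    using e E by auto
  have pow2: "(2 :: 'a) ^ n \<noteq> 0" for n
    using two by simp
  have nz: "(4 :: 'a) \<noteq> 0" "(16 :: 'a) \<noteq> 0" "(32 :: 'a) \<noteq> 0"
    using pow2[of 2] pow2[of 4] pow2[of 5] by simp_all
  \<comment> \<open>These are the conditions \<open>s\<close>, \<open>disc\<close> and
    \<open>det\<close> for \<open>e = 1\<close> and \<open>e = -1\<close> after simplification; the
    differences -1, 32 and 4 are units in odd characteristic.\<close>
  have "(3 :: 'a) \<noteq> 4" "(48 :: 'a) \<noteq> 16" "(6 :: 'a) \<noteq> 2"
    using right_minus_eq[of "3 :: 'a" 4] right_minus_eq[of "48 :: 'a" 16] right_minus_eq[of "6 :: 'a" 2] nz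
    by simp_all
  with nz have s: "4 - 3 * E\<^sup>2 \<noteq> 0" and disc: "(- 6 * E)\<^sup>2 \<noteq> 4 * (4 - 3 * E\<^sup>2)" and det: "2 - 6 * E\<^sup>2 \<noteq> 0"
    using E two by (auto simp: eq_diff_eq)
  interpret prime_form "- 6 * E" "4 - 3 * E\<^sup>2"
    by unfold_locales (use two s disc prime_field in auto)
  have "card (twists (- 6 * E)) = gcd (p - 1) (if e = 0 then 4 else 2)"
  proof (cases "e = 0")
    case True
    then have "twists (- 6 * E) = {u. u ^ 4 = 1}"
      by (auto simp: twists_def E_def)
    then show ?thesis
      using card_fourth_roots[OF two] True odd_p by (simp add: card_eq)
  next
    case False
    then have "twists (- 6 * E) = {u. u\<^sup>2 = 1}"
      using e by (intro twists_eq_square_roots) (auto simp: E_def)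
    moreover have "gcd (p - 1) 2 = 2"
      using odd_p by (intro gcd_proj2_if_dvd_nat) simp
    ultimately show ?thesis
      using card_square_roots_1[OF two] False by simp
  qed
  moreover have "card (tpairs (- 6 * E) (4 - 3 * E\<^sup>2)) = card (flexes :: ('a \<times> 'a) set)"
    by (rule bij_betw_same_card[OF bij_betw_tpairs_flexes[OF two E3 s disc]])
  ultimately show ?thesis
    using card_auto_G_B_Bfam[OF e3] det card_autos
    by (simp add: card_GL2 card_E1_3tors card_eq E_def[symmetric] algebra_simps)
qed

lemma card_auto_G_i1:
  assumes "i \<in> {1, 2, 3}"
  shows "card (auto (G_i1 i (int p)))
           = gcd (p - 1) (nat \<lceil>4 / real i\<rceil>) * card (GL2 (int p)) * p ^ 18 * card (E1_3tors (int p))"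
proof -
  have ceil: "nat \<lceil>4 / real 1\<rceil> = 4" "nat \<lceil>4 / real 2\<rceil> = 2" "nat \<lceil>4 / real 3\<rceil> = 2"
  proof -
    have "\<lceil>4 / 3 :: real\<rceil> = 2"
      by (simp add: ceiling_eq_iff)
    then show "nat \<lceil>4 / real 1\<rceil> = 4" "nat \<lceil>4 / real 2\<rceil> = 2" "nat \<lceil>4 / real 3\<rceil> = 2"
      by simp_all
  qed
  from assms consider "i = 1" | "i = 2" | "i = 3"
    by auto
  then show ?thesis
  proof cases
    case 1
    have "G_i1 i (int p) = G_B (Bfam 0) (int p)"
      by (simp add: G_i1_def 1 Bfam_instances)
    then show ?thesis
      using card_auto_G_B[of 0] unfolding 1 ceil by simp
  next
    case 2
    have "G_i1 i (int p) = G_B (Bfam 1) (int p)"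
      by (simp add: G_i1_def 2 Bfam_instances)
    then show ?thesis
      using card_auto_G_B[of 1] unfolding 2 ceil by simp
  next
    case 3
    have "G_i1 i (int p) = G_B (Bfam (-1)) (int p)"
      by (simp add: G_i1_def 3 Bfam_instances)
    then show ?thesis
      using card_auto_G_B[of "-1"] unfolding 3 ceil by simp
  qed
qed

end

section \<open>A field of generic prime order\<close>

definition aut_formula :: "nat \<Rightarrow> bool" where
  "aut_formula p \<longleftrightarrow> (\<forall>i \<in> {1, 2, 3}. card (auto (G_i1 i (int p)))
     = gcd (p - 1) (nat \<lceil>4 / real i\<rceil>) * card (GL2 (int p)) * p ^ 18 * card (E1_3tors (int p)))"

text \<open>HOL has no types depending on a number \<open>p\<close>. But the formula holds for all odd primes
  as soon as it holds for this one, which is chosen to be a counterexample if there is any.\<close>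

definition generic_prime :: nat where
  "generic_prime = (SOME p. prime p \<and> odd p \<and>
     (aut_formula p \<longrightarrow> (\<forall>q. prime q \<and> odd q \<longrightarrow> aut_formula q)))"

lemma generic_prime: "prime generic_prime" "odd generic_prime"
  "aut_formula generic_prime \<Longrightarrow> prime q \<Longrightarrow> odd q \<Longrightarrow> aut_formula q"
proof -
  have "\<exists>p. prime p \<and> odd p \<and> (aut_formula p \<longrightarrow> (\<forall>q. prime q \<and> odd q \<longrightarrow> aut_formula q))"
  proof (cases "\<forall>q. prime q \<and> odd q \<longrightarrow> aut_formula q")
    case True
    have "prime (3 :: nat)" "odd (3 :: nat)"
      by simp_all
    with True show ?thesis
      by blast
  qed blast
  then have "prime generic_prime \<and> odd generic_prime \<and>
      (aut_formula generic_prime \<longrightarrow> (\<forall>q. prime q \<and> odd q \<longrightarrow> aut_formula q))"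
    unfolding generic_prime_def by (rule someI_ex)
  then show "prime generic_prime" "odd generic_prime"
    "aut_formula generic_prime \<Longrightarrow> prime q \<Longrightarrow> odd q \<Longrightarrow> aut_formula q"
    by blast+
qed

lemma generic_prime_gt_1: "int generic_prime > 1"
  using prime_gt_1_nat[OF generic_prime(1)] by simp

section \<open>The residues modulo the generic prime as a field type\<close>

typedef fp = "{0..<int generic_prime}"
  using generic_prime_gt_1 by (intro exI[of _ 0]) simp

setup_lifting type_definition_fp

instantiation fp :: comm_ring_1
begin

lift_definition zero_fp :: fp is 0
  using generic_prime_gt_1 by simp

lift_definition one_fp :: fp is 1
  using generic_prime_gt_1 by simp

lift_definition plus_fp :: "fp \<Rightarrow> fp \<Rightarrow> fp" is "\<lambda>x y. (x + y) mod int generic_prime"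
  using generic_prime_gt_1 by simp

lift_definition minus_fp :: "fp \<Rightarrow> fp \<Rightarrow> fp" is "\<lambda>x y. (x - y) mod int generic_prime"
  using generic_prime_gt_1 by simp

lift_definition uminus_fp :: "fp \<Rightarrow> fp" is "\<lambda>x. (- x) mod int generic_prime"
  using generic_prime_gt_1 by simp

lift_definition times_fp :: "fp \<Rightarrow> fp \<Rightarrow> fp" is "\<lambda>x y. (x * y) mod int generic_prime"
  using generic_prime_gt_1 by simp

instance
proof
  fix a b c :: fp
  show "a + b + c = a + (b + c)"
    by transfer (simp add: mod_simps add.assoc)
  show "a + b = b + a"
    by transfer (simp add: add.commute)
  show "0 + a = a"
    by transfer simp
  show "- a + a = 0"
    by transfer (simp add: mod_simps)
  show "a - b = a + - b"
    by transfer (simp add: mod_simps)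
  show "a * b * c = a * (b * c)"
    by transfer (simp add: mod_simps mult.assoc)
  show "a * b = b * a"
    by transfer (simp add: mult.commute)
  show "1 * a = a"
    by transfer simp
  show "(a + b) * c = a * c + b * c"
    by transfer (simp add: mod_simps distrib_right)
  show "(0 :: fp) \<noteq> 1"
    by transfer simp
qed

end

lemma fp_ex_inverse:
  assumes "x \<noteq> 0"
  shows "\<exists>y :: fp. x * y = 1"
  using assms
proof transfer
  fix x
  assume x: "x \<in> {0..<int generic_prime}" "x \<noteq> 0"
  have "\<not> int generic_prime dvd x"
    using x by (auto dest: zdvd_imp_le)
  moreover have "prime (int generic_prime)"
    using generic_prime(1) by simp
  ultimately have "coprime x (int generic_prime)"
    by (metis coprime_commute prime_imp_coprime)
  then obtain y where "[x * y = 1] (mod int generic_prime)"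
    using cong_solve_coprime_int by blast
  then have "x * (y mod int generic_prime) mod int generic_prime = 1"
    using generic_prime_gt_1 by (simp add: cong_def mod_simps)
  then show "\<exists>y\<in>{y. y \<in> {0..<int generic_prime}}. x * y mod int generic_prime = 1"
    using generic_prime_gt_1 by (intro bexI[of _ "y mod int generic_prime"]) simp_all
qed

instantiation fp :: field
begin

definition inverse_fp :: "fp \<Rightarrow> fp" where
  "inverse_fp x = (if x = 0 then 0 else SOME y. x * y = 1)"

definition divide_fp :: "fp \<Rightarrow> fp \<Rightarrow> fp" where
  "divide_fp x y = x * inverse y"

instance
proof
  fix a b :: fp
  show "inverse a * a = 1" if "a \<noteq> 0"
    using someI_ex[OF fp_ex_inverse[OF that]] that by (simp add: inverse_fp_def mult.commute)
  show "a div b = a * inverse b"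
    by (rule divide_fp_def)
  show "inverse (0 :: fp) = 0"
    by (simp add: inverse_fp_def)
qed

end

lemma bij_Rep_fp: "bij_betw Rep_fp UNIV {0..<int generic_prime}"
  using type_definition.Rep_range[OF type_definition_fp] Rep_fp_inject
  by (auto simp: bij_betw_def inj_on_def)

instance fp :: finite_field
proof
  show "finite (UNIV :: fp set)"
    using bij_betw_finite[OF bij_Rep_fp] by simp
qed

lemma card_fp: "card (UNIV :: fp set) = generic_prime"
  using bij_betw_same_card[OF bij_Rep_fp] by simp

theorem theorem1p3:
  fixes p :: nat and i :: nat
  assumes "prime p" and "odd p" and "i \<in> {1, 2, 3}"
  shows "card (auto (G_i1 i (int p)))
           = gcd (p - 1) (nat \<lceil>4 / real i\<rceil>) * card (GL2 (int p)) * p ^ 18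
             * card (E1_3tors (int p))"
proof -
  interpret prime_order_field generic_prime "TYPE(fp)"
    by unfold_locales (rule card_fp generic_prime)+
  have "aut_formula generic_prime"
    unfolding aut_formula_def using card_auto_G_i1 by blast
  then have "aut_formula p"
    using assms(1,2) by (rule generic_prime(3))
  then show ?thesis
    using assms(3) unfolding aut_formula_def by blast
qed

end
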